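(* Let $s\in(4/3,4)$, and let $\mathbb{D}\subset\mathbb{R}^2$ be the unit disc. For $p\in(2,+\infty)$ put $q(p,s)=\frac{ps}{p+s-2}$. Then the following two statements are equivalent. (i) (Brennan's conjecture holds for the number $s$.) For every simply connected plane domain $\Omega\subset\mathbb{R}^2$ with nonempty boundary and every conformal homeomorphism $\varphi:\Omega\to\mathbb{D}$ one has $$\int_{\Omega}|\varphi'(z)|^{s}\,d\mu<+\infty .$$ (ii) For every simply connected plane domain $\Omega\subset\mathbb{R}^2$ with nonempty boundary, every conformal homeomorphism $\varphi:\Omega\to\mathbb{D}$ generates a bounded composition operator $$\varphi^{\ast}:L^1_{p}(\mathbb{D})\to L^1_{q(p,s)}(\Omega)$$ for every $p\in(2,+\infty)$.
   Context: Here $\mathbb{R}^2$ is identified with the complex plane, $\mu$ is two-dimensional Lebesgue measure, and conformal homeomorphisms are bijective onto the target domain; $\varphi'$ is the complex derivative, and $|\varphi'(z)|^2=J(z,\varphi)>0$, where $J(z,\varphi)$ is the Jacobian determinant of $\varphi$. For a domain $\Omega\subset\mathbb{R}^n$ and $1\le p<\infty$, the homogeneous Sobolev space $L^1_p(\Omega)$ is the space of all locally summable, weakly differentiable functions $f:\Omega\to\mathbb{R}$ with finite seminorm $$\|f\mid L^1_p(\Omega)\|=\Bigl(\int_\Omega|\nabla f(z)|^p\,d\mu\Bigr)^{1/p}.$$ A homeomorphism $\varphi:\Omega\to\Omega'$ between domains is said to generate a bounded composition operator $\varphi^{\ast}:L^1_p(\Omega')\to L^1_q(\Omega)$, $1\le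 q\le p$, by the composition rule $\varphi^{\ast}(f)=f\circ\varphi$, if for every $f\in L^1_p(\Omega')$ the function $f\circ\varphi$ belongs to $L^1_q(\Omega)$ and there is a constant $K<\infty$ (independent of $f$) such that $\|f\circ\varphi\mid L^1_q(\Omega)\|\le K\|f\mid L^1_p(\Omega')\|$ for all $f\in L^1_p(\Omega')$. *)

theory Defs
  imports "HOL-Complex_Analysis.Complex_Analysis"
begin

(* The derivative in every direction v is required to be C^k again; on the whole
   space this is the usual class C^k. *)
fun Ck_function :: "nat \<Rightarrow> ('a::euclidean_space \<Rightarrow> real) \<Rightarrow> bool" where
  "Ck_function 0 f \<longleftrightarrow> continuous_on UNIV f"
| "Ck_function (Suc k) f \<longleftrightarrow>
     (\<forall>x. f differentiable (at x)) \<and>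
     (\<forall>v. Ck_function k (\<lambda>x. frechet_derivative f (at x) v))"

definition test_function_on :: "'a::euclidean_space set \<Rightarrow> ('a \<Rightarrow> real) \<Rightarrow> bool" where
  "test_function_on \<Omega> \<psi> \<longleftrightarrow>
     (\<forall>k. Ck_function k \<psi>) \<and>
     compact (closure {x. \<psi> x \<noteq> 0}) \<and> closure {x. \<psi> x \<noteq> 0} \<subseteq> \<Omega>"

definition locally_summable_on ::
  "'a::euclidean_space set \<Rightarrow> ('a \<Rightarrow> 'b::euclidean_space) \<Rightarrow> bool" where
  "locally_summable_on \<Omega> f \<longleftrightarrow>
     (\<forall>K. compact K \<and> K \<subseteq> \<Omega> \<longrightarrow> f absolutely_integrable_on K)"

definition has_weak_gradient_on ::
  "('a::euclidean_space \<Rightarrow> real) \<Rightarrow> ('a \<Rightarrow> 'a) \<Rightarrow> 'a set \<Rightarrow> bool" where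
  "has_weak_gradient_on f g \<Omega> \<longleftrightarrow>
     locally_summable_on \<Omega> g \<and>
     (\<forall>\<psi>. test_function_on \<Omega> \<psi> \<longrightarrow>
        (\<forall>b\<in>Basis. (LINT x:\<Omega>|lebesgue. f x * frechet_derivative \<psi> (at x) b)
                 = - (LINT x:\<Omega>|lebesgue. (g x \<bullet> b) * \<psi> x)))"

definition weakly_differentiable_on ::
  "('a::euclidean_space \<Rightarrow> real) \<Rightarrow> 'a set \<Rightarrow> bool" where
  "weakly_differentiable_on f \<Omega> \<longleftrightarrow> (\<exists>g. has_weak_gradient_on f g \<Omega>)"

(* On an open set the weak gradient is determined up to a null set, so the choice does
   not affect integrals; it is arbitrary if f is not weakly differentiable. *)
definition weak_gradient ::
  "'a::euclidean_space set \<Rightarrow> ('a \<Rightarrow> real) \<Rightarrow> 'a \<Rightarrow> 'a" where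
  "weak_gradient \<Omega> f = (SOME g. has_weak_gradient_on f g \<Omega>)"

(* The homogeneous Sobolev space L^1_p(\<Omega>), 1 \<le> p < \<infinity>. Elements are honest functions,
   of which only the values on \<Omega> matter. *)
definition sobolev_L1 ::
  "real \<Rightarrow> 'a::euclidean_space set \<Rightarrow> ('a \<Rightarrow> real) set" where
  "sobolev_L1 p \<Omega> =
     {f. locally_summable_on \<Omega> f \<and> weakly_differentiable_on f \<Omega> \<and>
         set_integrable lebesgue \<Omega> (\<lambda>x. norm (weak_gradient \<Omega> f x) powr p)}"

definition sobolev_seminorm ::
  "real \<Rightarrow> 'a::euclidean_space set \<Rightarrow> ('a \<Rightarrow> real) \<Rightarrow> real" where
  "sobolev_seminorm p \<Omega> f =
     (LINT x:\<Omega>|lebesgue. norm (weak_gradient \<Omega> f x) powr p) powr (1 / p)"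

definition generates_bounded_composition_operator ::
  "real \<Rightarrow> real \<Rightarrow> 'a::euclidean_space set \<Rightarrow> 'a set \<Rightarrow> ('a \<Rightarrow> 'a) \<Rightarrow> bool" where
  "generates_bounded_composition_operator p q \<Omega> \<Omega>' \<phi> \<longleftrightarrow>
     (\<forall>f\<in>sobolev_L1 p \<Omega>'. f \<circ> \<phi> \<in> sobolev_L1 q \<Omega>) \<and>
     (\<exists>K. \<forall>f\<in>sobolev_L1 p \<Omega>'.
        sobolev_seminorm q \<Omega> (f \<circ> \<phi>) \<le> K * sobolev_seminorm p \<Omega>' f)"

definition simply_connected_plane_domain :: "complex set \<Rightarrow> bool" where
  "simply_connected_plane_domain \<Omega> \<longleftrightarrow>
     open \<Omega> \<and> connected \<Omega> \<and> \<Omega> \<noteq> {} \<and> simply_connected \<Omega>"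

(* Nonvanishing of the derivative follows from injectivity. *)
definition conformal_homeomorphism ::
  "complex set \<Rightarrow> complex set \<Rightarrow> (complex \<Rightarrow> complex) \<Rightarrow> bool" where
  "conformal_homeomorphism \<Omega> \<Omega>' \<phi> \<longleftrightarrow>
     \<phi> holomorphic_on \<Omega> \<and> (\<exists>\<phi>_inv. homeomorphism \<Omega> \<Omega>' \<phi> \<phi>_inv)"

definition brennan_conjecture_holds_for :: "real \<Rightarrow> bool" where
  "brennan_conjecture_holds_for s \<longleftrightarrow>
     (\<forall>\<Omega> \<phi>. simply_connected_plane_domain \<Omega> \<and> frontier \<Omega> \<noteq> {} \<and>
            conformal_homeomorphism \<Omega> (ball 0 1) \<phi> \<longrightarrow>
        (\<integral>\<^sup>+z\<in>\<Omega>. ennreal (cmod (deriv \<phi> z) powr s) \<partial>lebesgue) < \<infinity>)"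

definition composition_exponent :: "real \<Rightarrow> real \<Rightarrow> real" where
  "composition_exponent p s = p * s / (p + s - 2)"

end

theory Submission
  imports Defs "HOL-Real_Asymp.Real_Asymp"
begin

text \<open>
  Write \<open>h\<close> for the inverse of \<open>\<phi>\<close>, \<open>D\<close> for the disc and \<open>q = p s / (p + s - 2)\<close>. The exponents are chosen
  such that \<open>s (p - q) = q (p - 2)\<close>. The equivalence already holds for each single \<open>\<Omega>\<close>, \<open>\<phi>\<close> and
  \<open>p > 2\<close> (lemma \<open>conformal_composition_iff\<close>), and the theorem quantifies over them.

  The weak gradient of \<open>f \<circ> \<phi>\<close> is \<open>cnj \<phi>' * (\<nabla>f \<circ> \<phi>)\<close> (\<open>weak_gradient_compose\<close>), so the
  \<open>L\<^sup>q\<close>-norm of the gradient on \<open>\<Omega>\<close> is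
  \<open>\<integral>\<^bsub>\<Omega>\<^esub> |\<phi>'|\<^sup>q |\<nabla>f \<circ> \<phi>|\<^sup>q\<close>. If \<open>|\<phi>'|\<^sup>s\<close> is integrable, split
  \<open>|\<phi>'|\<^sup>q |\<nabla>f \<circ> \<phi>|\<^sup>q = (|\<phi>'|\<^sup>2 |\<nabla>f \<circ> \<phi>|\<^sup>p)\<^bsup>q/p\<^esup> (|\<phi>'|\<^sup>s)\<^bsup>1-q/p\<^esup>\<close>
  and apply Hoelder's inequality; the first factor integrates to \<open>\<integral>\<^bsub>D\<^esub> |\<nabla>f|\<^sup>p\<close> because
  \<open>|\<phi>'|\<^sup>2\<close> is the Jacobian (\<open>composition_operator_bounded\<close>).

  Conversely, Hoelder's inequality is sharp when \<open>|\<nabla>f|\<close> equals \<open>\<rho> = |h'|\<^bsup>(2-s)/p\<^esup>\<close>. To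
  produce (approximately) a gradient of prescribed modulus \<open>a\<close>, oscillate fast: for
  \<open>f\<^sub>1 = a cos (n x) / n\<close> and \<open>f\<^sub>2 = a sin (n x) / n\<close> one has exactly
  \<open>|\<nabla>f\<^sub>1|\<^sup>2 + |\<nabla>f\<^sub>2|\<^sup>2 = a\<^sup>2 + |\<nabla>a|\<^sup>2 / n\<^sup>2\<close>.
  Letting \<open>n\<close> tend to infinity shows that a bounded composition operator controls
  \<open>\<integral>\<^bsub>\<Omega>\<^esub> |\<phi>'|\<^sup>q (a \<circ> \<phi>)\<^sup>q\<close> by \<open>(\<integral>\<^bsub>D\<^esub> a\<^sup>p)\<^bsup>q/p\<^esup>\<close> for every smooth
  compactly supported \<open>a\<close>, whether or not \<open>a\<close> is itself a gradient modulus
  (\<open>composition_bound_amplitude\<close>). With \<open>a = \<rho> \<tau>\<^sub>m\<close> for cutoffs \<open>0 \<le> \<tau>\<^sub>m \<le> 1\<close> tending to 1,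
  both sides are expressed through \<open>X\<^sub>m = \<integral>\<^bsub>\<Omega>\<^esub> |\<phi>'|\<^sup>s (\<tau>\<^sub>m \<circ> \<phi>)\<^sup>q\<close>, giving
  \<open>X\<^sub>m \<le> c X\<^sub>m\<^bsup>q/p\<^esup>\<close>. Since \<open>X\<^sub>m\<close> is finite and \<open>q < p\<close>, the \<open>X\<^sub>m\<close> are bounded, and Fatou's
  lemma yields the integrability of \<open>|\<phi>'|\<^sup>s\<close>.

  Weak gradients are only determined almost everywhere, and the chosen representative is
  arbitrary; that integrals do not depend on the choice is the fundamental lemma of the calculus of
  variations, for which smooth bump functions are built from \<open>exp (- 1 / x)\<close>.
\<close>

section \<open>Holomorphic change of variables for Lebesgue integrals\<close>

definition plane_of_vec :: "real^2 \<Rightarrow> complex" where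
  "plane_of_vec x = Complex (x$1) (x$2)"

definition vec_of_plane :: "complex \<Rightarrow> real^2" where
  "vec_of_plane z = vector [Re z, Im z]"

lemma plane_vec_inverse [simp]:
  "plane_of_vec (vec_of_plane z) = z" "vec_of_plane (plane_of_vec x) = x"
  by (auto simp: plane_of_vec_def vec_of_plane_def vec_eq_iff forall_2)

lemma linear_plane_of_vec: "linear plane_of_vec"
  by (rule linearI) (auto simp: plane_of_vec_def complex_eq_iff)

lemma linear_vec_of_plane: "linear vec_of_plane"
  by (rule linearI) (auto simp: vec_of_plane_def vec_eq_iff forall_2)

text \<open>Borel sets are determined by boxes; passing to the completion is possible because \<open>T\<close> then
  also preserves null sets. The point is to transport the change of variables formula between
  \<open>real^2\<close> and the complex plane.\<close>

lemma linear_preserves_lebesgue: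
  fixes T :: "'a::euclidean_space \<Rightarrow> 'b::euclidean_space"
  assumes "linear T"
    and box: "\<And>l u. (\<And>b. b \<in> Basis \<Longrightarrow> l \<bullet> b \<le> u \<bullet> b) \<Longrightarrow>
       emeasure lborel (T -` box l u) = (\<Prod>b\<in>Basis. (u - l) \<bullet> b)"
  shows "T \<in> lebesgue \<rightarrow>\<^sub>M lebesgue" and "distr lebesgue lebesgue T = lebesgue"
proof -
  have T[measurable]: "T \<in> borel_measurable borel"
    using assms(1) by (intro borel_measurable_continuous_onI linear_continuous_on) (simp add: linear_linear)
  have D: "lborel = distr lborel borel T"
    by (rule lborel_eqI) (auto simp: emeasure_distr box)
  have D': "distr lebesgue lborel T = lborel"
  proof -
    have "distr (completion lborel) lborel T = distr lborel lborel T"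
      by (rule distr_completion) simp
    also have "\<dots> = distr lborel borel T" by (rule distr_cong) auto
    finally show ?thesis using D by simp
  qed
  have Tm: "T \<in> lebesgue \<rightarrow>\<^sub>M lborel" by (rule measurable_completion) simp
  show "T \<in> lebesgue \<rightarrow>\<^sub>M lebesgue"
    by (rule completion.measurable_completion2[OF Tm]) (simp add: D')
  show "distr lebesgue lebesgue T = lebesgue"
    using completion.completion_distr_eq[OF Tm] by (simp add: D')
qed

lemma vec2_box: "box (l::real^2) u = {x. l$1 < x$1 \<and> x$1 < u$1 \<and> l$2 < x$2 \<and> x$2 < u$2}"
  by (auto simp: mem_box_cart forall_2)

lemma complex_box: "box l u = {z. Re l < Re z \<and> Re z < Re u \<and> Im l < Im z \<and> Im z < Im u}"
  by (auto simp: in_box_complex_iff)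

lemma vec2_Basis: "Basis = {axis 1 1, axis 2 1 :: real^2}"
  by (auto simp: Basis_vec_def) (metis exhaust_2)+

lemma distr_plane_of_vec:
  "plane_of_vec \<in> lebesgue \<rightarrow>\<^sub>M lebesgue" "distr lebesgue lebesgue plane_of_vec = lebesgue"
proof -
  have box: "emeasure lborel (plane_of_vec -` box l u) = (\<Prod>b\<in>Basis. (u - l) \<bullet> b)"
    if le: "\<And>b. b \<in> Basis \<Longrightarrow> l \<bullet> b \<le> u \<bullet> b" for l u
  proof -
    have le': "Re l \<le> Re u" "Im l \<le> Im u"
      using le[of 1] le[of \<i>] by (simp_all add: Basis_complex_def)
    have "plane_of_vec -` box l u = box (vec_of_plane l) (vec_of_plane u)"
      unfolding vec2_box complex_box by (auto simp: plane_of_vec_def vec_of_plane_def)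
    then show ?thesis using le'
      by (simp add: emeasure_lborel_box_eq Basis_complex_def vec2_Basis vec_of_plane_def
             axis_eq_axis inner_axis)
  qed
  from linear_preserves_lebesgue[OF linear_plane_of_vec box]
  show "plane_of_vec \<in> lebesgue \<rightarrow>\<^sub>M lebesgue" "distr lebesgue lebesgue plane_of_vec = lebesgue" by auto
qed

lemma distr_vec_of_plane:
  "vec_of_plane \<in> lebesgue \<rightarrow>\<^sub>M lebesgue" "distr lebesgue lebesgue vec_of_plane = lebesgue"
proof -
  have box: "emeasure lborel (vec_of_plane -` box l u) = (\<Prod>b\<in>Basis. (u - l) \<bullet> b)"
    if le: "\<And>b. b \<in> Basis \<Longrightarrow> l \<bullet> b \<le> u \<bullet> b" for l u
  proof -
    have le': "l$1 \<le> u$1" "l$2 \<le> u$2"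
      using le[of "axis 1 1"] le[of "axis 2 1"] by (simp_all add: vec2_Basis inner_axis)
    have "vec_of_plane -` box l u = box (plane_of_vec l) (plane_of_vec u)"
      unfolding vec2_box complex_box by (auto simp: plane_of_vec_def vec_of_plane_def)
    then show ?thesis using le'
      by (simp add: emeasure_lborel_box_eq Basis_complex_def vec2_Basis plane_of_vec_def
             axis_eq_axis inner_axis)
  qed
  from linear_preserves_lebesgue[OF linear_vec_of_plane box]
  show "vec_of_plane \<in> lebesgue \<rightarrow>\<^sub>M lebesgue" "distr lebesgue lebesgue vec_of_plane = lebesgue" by auto
qed

lemma plane_vec_integral:
  fixes f :: "complex \<Rightarrow> real"
  shows "integrable lebesgue f \<longleftrightarrow> integrable lebesgue (\<lambda>x. f (plane_of_vec x))"
    and "(LINT z|lebesgue. f z) = (LINT x|lebesgue. f (plane_of_vec x))"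
proof -
  have m: "f \<in> borel_measurable lebesgue" if "(\<lambda>x. f (plane_of_vec x)) \<in> borel_measurable lebesgue"
    using measurable_compose[OF distr_vec_of_plane(1) that] by simp
  have m': "(\<lambda>x. f (plane_of_vec x)) \<in> borel_measurable lebesgue" if "f \<in> borel_measurable lebesgue"
    using measurable_compose[OF distr_plane_of_vec(1) that] by simp
  show *: "integrable lebesgue f \<longleftrightarrow> integrable lebesgue (\<lambda>x. f (plane_of_vec x))"
  proof (cases "f \<in> borel_measurable lebesgue")
    case True
    then show ?thesis
      using integrable_distr_eq[OF distr_plane_of_vec(1), of f] unfolding distr_plane_of_vec(2) by blast
  next
    case False
    then show ?thesis using m borel_measurable_integrable by blast
  qed
  show "(LINT z|lebesgue. f z) = (LINT x|lebesgue. f (plane_of_vec x))"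
  proof (cases "f \<in> borel_measurable lebesgue")
    case True
    then show ?thesis
      using integral_distr[OF distr_plane_of_vec(1), of f] unfolding distr_plane_of_vec(2) by blast
  next
    case False
    then show ?thesis using m * not_integrable_integral_eq borel_measurable_integrable by metis
  qed
qed

text \<open>The Jacobian determinant of a holomorphic map is \<open>|\<phi>'|\<^sup>2\<close>, by the Cauchy-Riemann equations.\<close>

lemma holomorphic_change_of_variables:
  fixes f :: "complex \<Rightarrow> real"
  assumes S: "S \<in> sets lebesgue" "S \<subseteq> A" and A: "open A" "\<phi> holomorphic_on A" "inj_on \<phi> A"
  shows "set_integrable lebesgue S (\<lambda>z. (cmod (deriv \<phi> z))\<^sup>2 * f (\<phi> z)) \<longleftrightarrow>
           set_integrable lebesgue (\<phi> ` S) f" (is ?I)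
    and "set_integrable lebesgue (\<phi> ` S) f \<Longrightarrow>
     (LINT z:S|lebesgue. (cmod (deriv \<phi> z))\<^sup>2 * f (\<phi> z)) = (LINT w:\<phi> ` S|lebesgue. f w)" (is "_ \<Longrightarrow> ?E")
proof -
  define T where "T = vec_of_plane ` S"
  define g where "g = vec_of_plane \<circ> \<phi> \<circ> plane_of_vec"
  define g' where "g' x = vec_of_plane \<circ> ((*) (deriv \<phi> (plane_of_vec x))) \<circ> plane_of_vec" for x
  define F :: "real^2 \<Rightarrow> real^1" where "F = vec \<circ> f \<circ> plane_of_vec"
  have T: "T \<in> sets lebesgue"
  proof -
    have "T = plane_of_vec -` S \<inter> space lebesgue"
      unfolding T_def by (auto simp: image_iff) (metis plane_vec_inverse(2))
    then show ?thesis using measurable_sets[OF distr_plane_of_vec(1) S(1)] by simp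
  qed
  have der: "(g has_derivative g' x) (at x within T)" if "x \<in> T" for x
  proof -
    have "plane_of_vec x \<in> A" using that S(2) by (auto simp: T_def)
    then have "(\<phi> has_field_derivative deriv \<phi> (plane_of_vec x)) (at (plane_of_vec x))"
      using A holomorphic_derivI by blast
    then have 1: "(\<phi> has_derivative (*) (deriv \<phi> (plane_of_vec x))) (at (plane_of_vec x))"
      by (simp add: has_field_derivative_def)
    have 2: "(plane_of_vec has_derivative plane_of_vec) (at x)"
      using linear_plane_of_vec by (simp add: linear_linear bounded_linear_imp_has_derivative)
    have 3: "(vec_of_plane has_derivative vec_of_plane) (at y)" for y
      using linear_vec_of_plane by (simp add: linear_linear bounded_linear_imp_has_derivative)
    show ?thesis unfolding g_def g'_def
      by (rule has_derivative_at_withinI, rule diff_chain_at[OF 2], rule diff_chain_at[OF 1[folded o_def] 3])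
  qed
  have inj: "inj_on g T"
  proof (rule inj_onI)
    fix x y assume "x \<in> T" "y \<in> T" and e: "g x = g y"
    then have "plane_of_vec x \<in> A" "plane_of_vec y \<in> A" using S(2) by (auto simp: T_def)
    moreover have "\<phi> (plane_of_vec x) = \<phi> (plane_of_vec y)"
      using arg_cong[OF e, of plane_of_vec] by (simp add: g_def)
    ultimately have "plane_of_vec x = plane_of_vec y" using A(3) by (auto dest: inj_onD)
    then show "x = y" using plane_vec_inverse(2) by metis
  qed
  have det: "\<bar>det (matrix (g' x))\<bar> = (cmod (deriv \<phi> (plane_of_vec x)))\<^sup>2" for x
  proof -
    have "det (matrix (g' x)) = (Re (deriv \<phi> (plane_of_vec x)))\<^sup>2 + (Im (deriv \<phi> (plane_of_vec x)))\<^sup>2"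
      by (simp add: det_2 matrix_def g'_def vec_of_plane_def plane_of_vec_def axis_def power2_eq_square)
    then show ?thesis by (simp add: cmod_power2)
  qed
  have gT: "g ` T = vec_of_plane ` \<phi> ` S"
    by (auto simp: g_def T_def image_iff)
  have cov: "(\<lambda>x. \<bar>det (matrix (g' x))\<bar> *\<^sub>R F (g x)) absolutely_integrable_on T \<and>
          integral T (\<lambda>x. \<bar>det (matrix (g' x))\<bar> *\<^sub>R F (g x)) = b
     \<longleftrightarrow> F absolutely_integrable_on (g ` T) \<and> integral (g ` T) F = b" for b
    by (rule has_absolute_integral_change_of_variables[OF T der inj])
  have img: "indicator (vec_of_plane ` R) x = (indicator R (plane_of_vec x) :: real)" for R x
    by (auto simp: indicator_def image_iff) (metis plane_vec_inverse(2))
  have tr: "set_integrable lebesgue R u \<longleftrightarrow> set_integrable lebesgue (vec_of_plane ` R) (u \<circ> plane_of_vec)"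
           "set_lebesgue_integral lebesgue R u = set_lebesgue_integral lebesgue (vec_of_plane ` R) (u \<circ> plane_of_vec)"
    for R and u :: "complex \<Rightarrow> real"
    unfolding set_integrable_def set_lebesgue_integral_def o_def img
    by (rule plane_vec_integral)+
  have F1: "(\<lambda>x. \<bar>det (matrix (g' x))\<bar> *\<^sub>R F (g x)) absolutely_integrable_on T \<longleftrightarrow>
     set_integrable lebesgue S (\<lambda>z. (cmod (deriv \<phi> z))\<^sup>2 * f (\<phi> z))"
    unfolding tr(1)[of S] absolutely_integrable_on_1_iff det T_def[symmetric]
    by (simp add: F_def g_def o_def)
  have F2: "F absolutely_integrable_on (g ` T) \<longleftrightarrow> set_integrable lebesgue (\<phi> ` S) f"
    unfolding tr(1)[of "\<phi> ` S"] absolutely_integrable_on_1_iff gT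
    by (simp add: F_def g_def o_def)
  show I: ?I using cov F1 F2 by blast
  assume f: "set_integrable lebesgue (\<phi> ` S) f"
  have "integral T (\<lambda>x. \<bar>det (matrix (g' x))\<bar> *\<^sub>R F (g x)) = integral (g ` T) F"
    using cov f F2 by blast
  then have "integral T (\<lambda>x. \<bar>det (matrix (g' x))\<bar> * f (plane_of_vec (g x))) = integral (g ` T) (f \<circ> plane_of_vec)"
    by (simp add: integral_on_1_eq F_def o_def vec_eq_iff)
  moreover have "set_integrable lebesgue (g ` T) (f \<circ> plane_of_vec)"
    using f tr(1) gT by metis
  moreover have "set_integrable lebesgue T (\<lambda>x. \<bar>det (matrix (g' x))\<bar> * f (plane_of_vec (g x)))"
    using f I tr(1)[of S] unfolding T_def det g_def o_def by simp
  ultimately have "set_lebesgue_integral lebesgue T (\<lambda>x. \<bar>det (matrix (g' x))\<bar> * f (plane_of_vec (g x)))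
     = set_lebesgue_integral lebesgue (g ` T) (f \<circ> plane_of_vec)"
    by (simp add: set_lebesgue_integral_eq_integral)
  then show ?E
    unfolding tr(2)[of S] tr(2)[of "\<phi> ` S"] gT[symmetric] T_def[symmetric] det
    by (simp add: o_def g_def)
qed

section \<open>Smooth functions on open sets\<close>

text \<open>The localised form of \<^const>\<open>Ck_function\<close>: pulling a test function back along a conformal map gives
  a function which is smooth on the target domain and, for a different reason, smooth off its support;
  the two pieces are glued by \<open>Ck_on_Un\<close>.\<close>

fun Ck_on :: "'a::euclidean_space set \<Rightarrow> nat \<Rightarrow> ('a \<Rightarrow> real) \<Rightarrow> bool" where
  "Ck_on S 0 f \<longleftrightarrow> continuous_on S f"
| "Ck_on S (Suc k) f \<longleftrightarrow>
     (\<forall>x\<in>S. f differentiable (at x)) \<and> (\<forall>v. Ck_on S k (\<lambda>x. frechet_derivative f (at x) v))"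

lemma Ck_function_eq: "Ck_function k f \<longleftrightarrow> Ck_on UNIV k f"
  by (induction k arbitrary: f) auto

lemma Ck_on_cong:
  assumes "open S" "Ck_on S k f" "\<And>x. x \<in> S \<Longrightarrow> f x = g x"
  shows "Ck_on S k g"
  using assms(2,3)
proof (induction k arbitrary: f g)
  case 0
  then show ?case using continuous_on_cong[of S S f g] by simp
next
  case (Suc k)
  have fr: "frechet_derivative f (at x) = frechet_derivative g (at x)" "g differentiable (at x)" if "x \<in> S" for x
  proof -
    have d: "(f has_derivative frechet_derivative f (at x)) (at x)"
      using Suc.prems that by (simp add: frechet_derivative_works)
    have "(g has_derivative frechet_derivative f (at x)) (at x)"
      by (rule has_derivative_transform_within_open[OF d assms(1) that]) (use Suc.prems in auto)
    then show "frechet_derivative f (at x) = frechet_derivative g (at x)" "g differentiable (at x)"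
      by (auto simp: frechet_derivative_at differentiable_def)
  qed
  have "Ck_on S k (\<lambda>x. frechet_derivative g (at x) v)" for v
  proof (rule Suc.IH)
    show "Ck_on S k (\<lambda>x. frechet_derivative f (at x) v)" using Suc.prems(1) by simp
  qed (simp add: fr(1))
  then show ?case using fr(2) by simp
qed

lemma Ck_on_SucI:
  assumes "open S" "\<And>x. x \<in> S \<Longrightarrow> (f has_derivative D x) (at x)" "\<And>v. Ck_on S k (\<lambda>x. D x v)"
  shows "Ck_on S (Suc k) f"
proof -
  have "Ck_on S k (\<lambda>x. frechet_derivative f (at x) v)" for v
    by (rule Ck_on_cong[OF assms(1) assms(3)[of v]]) (use assms(2) frechet_derivative_at in metis)
  then show ?thesis using assms(2) by (auto simp: differentiable_def)
qed

lemma Ck_on_SucD: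
  assumes "Ck_on S (Suc k) f" "x \<in> S"
  shows "(f has_derivative frechet_derivative f (at x)) (at x)"
  using assms by (simp add: frechet_derivative_works)

lemma Ck_on_Suc_imp: "Ck_on S (Suc k) f \<Longrightarrow> Ck_on S k f"
proof (induction k arbitrary: f)
  case 0
  then show ?case
    by (simp add: continuous_at_imp_continuous_on differentiable_imp_continuous_within)
next
  case (Suc k)
  have "Ck_on S k (\<lambda>x. frechet_derivative f (at x) v)" for v
    by (rule Suc.IH) (use Suc.prems in simp)
  then show ?case using Suc.prems by simp
qed

lemma Ck_on_continuous: "Ck_on S k f \<Longrightarrow> continuous_on S f"
proof (induction k)
  case (Suc k)
  then show ?case using Ck_on_Suc_imp by blast
qed simp

lemma Ck_on_subset: "Ck_on S k f \<Longrightarrow> T \<subseteq> S \<Longrightarrow> Ck_on T k f"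
proof (induction k arbitrary: f)
  case 0
  then show ?case using continuous_on_subset by auto
next
  case (Suc k)
  have "Ck_on T k (\<lambda>x. frechet_derivative f (at x) v)" for v
    by (rule Suc.IH) (use Suc.prems in simp_all)
  then show ?case using Suc.prems by auto
qed

lemma Ck_on_Un:
  assumes "open S" "open T" "Ck_on S k f" "Ck_on T k f" shows "Ck_on (S \<union> T) k f"
  using assms(3,4)
proof (induction k arbitrary: f)
  case 0
  then show ?case using continuous_on_open_Un[OF assms(1,2)] by simp
next
  case (Suc k)
  have "Ck_on (S \<union> T) k (\<lambda>x. frechet_derivative f (at x) v)" for v
    by (rule Suc.IH) (use Suc.prems in simp_all)
  then show ?case using Suc.prems by auto
qed

lemma Ck_on_const: "open S \<Longrightarrow> Ck_on S k (\<lambda>x. c)"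
proof (induction k arbitrary: c)
  case (Suc k)
  then show ?case by (intro Ck_on_SucI[where D="\<lambda>x v. 0"]) auto
qed auto

lemma Ck_on_add:
  assumes "open S" shows "Ck_on S k f \<Longrightarrow> Ck_on S k g \<Longrightarrow> Ck_on S k (\<lambda>x. f x + g x)"
proof (induction k arbitrary: f g)
  case (Suc k)
  have "Ck_on S k (\<lambda>x. frechet_derivative f (at x) v + frechet_derivative g (at x) v)" for v
    by (rule Suc.IH) (use Suc.prems in simp_all)
  then show ?case
    using Ck_on_SucI[OF assms has_derivative_add[OF Ck_on_SucD[OF Suc.prems(1)] Ck_on_SucD[OF Suc.prems(2)]]] by blast
qed (auto intro: continuous_intros)

lemma Ck_on_mult:
  assumes "open S" shows "Ck_on S k f \<Longrightarrow> Ck_on S k g \<Longrightarrow> Ck_on S k (\<lambda>x. f x * g x)"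
proof (induction k arbitrary: f g)
  case (Suc k)
  have "Ck_on S k (\<lambda>x. f x * frechet_derivative g (at x) v + frechet_derivative f (at x) v * g x)" for v
  proof (rule Ck_on_add[OF assms])
    have "Ck_on S k f" "Ck_on S k g" using Suc.prems Ck_on_Suc_imp by blast+
    then show "Ck_on S k (\<lambda>x. f x * frechet_derivative g (at x) v)"
        "Ck_on S k (\<lambda>x. frechet_derivative f (at x) v * g x)"
      by (auto intro!: Suc.IH simp: Suc.prems[unfolded Ck_on.simps(2)])
  qed
  then show ?case
    using Ck_on_SucI[OF assms has_derivative_mult[OF Ck_on_SucD[OF Suc.prems(1)] Ck_on_SucD[OF Suc.prems(2)]]] by blast
qed (auto intro: continuous_intros)

lemma Ck_on_Re_holomorphic:
  assumes "open S" "F holomorphic_on S" shows "Ck_on S k (\<lambda>z. Re (F z))"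
  using assms(2)
proof (induction k arbitrary: F)
  case 0
  then show ?case by (auto intro!: continuous_intros holomorphic_on_imp_continuous_on)
next
  case (Suc k)
  show ?case
  proof (rule Ck_on_SucI[OF assms(1), where D="\<lambda>z v. Re (deriv F z * v)"])
    fix z assume "z \<in> S"
    then have "(F has_derivative (*) (deriv F z)) (at z)"
      using holomorphic_derivI[OF Suc.prems assms(1)] by (simp add: has_field_derivative_def)
    then show "((\<lambda>z. Re (F z)) has_derivative (\<lambda>v. Re (deriv F z * v))) (at z)"
      by (auto intro!: derivative_eq_intros)
  next
    show "Ck_on S k (\<lambda>z. Re (deriv F z * v))" for v
      by (rule Suc.IH) (intro holomorphic_intros holomorphic_deriv Suc.prems assms)
  qed
qed

lemma complex_linear_expand:
  fixes L :: "complex \<Rightarrow> real"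
  assumes "linear L" shows "L z = Re z * L 1 + Im z * L \<i>"
proof -
  have "L z = L (Re z *\<^sub>R 1 + Im z *\<^sub>R \<i>)"
    by (rule arg_cong[of _ _ L]) (simp add: complex_eq_iff)
  then show ?thesis using assms by (simp add: linear_add linear_scale)
qed

text \<open>The derivative of \<open>f \<circ> h\<close> in direction \<open>v\<close> is expanded along \<open>1\<close> and \<open>\<i>\<close>, so that it is a sum
  of products of real parts of holomorphic functions with functions \<open>D f \<circ> h\<close>, to which the induction
  hypothesis applies.\<close>

lemma Ck_on_compose_holomorphic:
  assumes S: "open S" "h holomorphic_on S" "h ` S \<subseteq> T" and "Ck_on T k f"
  shows "Ck_on S k (\<lambda>z. f (h z))"
  using assms(4)
proof (induction k arbitrary: f)
  case 0
  then show ?case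
    using continuous_on_compose2[of T f S h] S by (auto intro: holomorphic_on_imp_continuous_on)
next
  case (Suc k)
  let ?D = "\<lambda>z v. frechet_derivative f (at (h z)) v"
  have d: "(f has_derivative ?D z) (at (h z))" if "z \<in> S" for z
    using Ck_on_SucD[OF Suc.prems] S that by blast
  have Ck: "Ck_on S k (\<lambda>z. ?D z v)" for v
    using Suc.IH[of "\<lambda>x. frechet_derivative f (at x) v"] Suc.prems by simp
  show ?case
  proof (rule Ck_on_SucI[OF S(1), where D="\<lambda>z v. Re (deriv h z * v) * ?D z 1 + Re (- \<i> * (deriv h z * v)) * ?D z \<i>"])
    fix z assume z: "z \<in> S"
    then have "(h has_derivative (*) (deriv h z)) (at z)"
      using holomorphic_derivI[OF S(2,1)] by (simp add: has_field_derivative_def)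
    from diff_chain_at[OF this d[OF z]]
    have "((\<lambda>z. f (h z)) has_derivative (\<lambda>v. ?D z (deriv h z * v))) (at z)" by (simp add: o_def)
    moreover have "linear (?D z)" using d[OF z] has_derivative_linear by blast
    then have "?D z (deriv h z * v) = Re (deriv h z * v) * ?D z 1 + Re (- \<i> * (deriv h z * v)) * ?D z \<i>" for v
      using complex_linear_expand[of "?D z" "deriv h z * v"] by simp
    ultimately show "((\<lambda>z. f (h z)) has_derivative
        (\<lambda>v. Re (deriv h z * v) * ?D z 1 + Re (- \<i> * (deriv h z * v)) * ?D z \<i>)) (at z)" by simp
  next
    show "Ck_on S k (\<lambda>z. Re (deriv h z * v) * ?D z 1 + Re (- \<i> * (deriv h z * v)) * ?D z \<i>)" for v
      by (intro Ck_on_add Ck_on_mult Ck Ck_on_Re_holomorphic S holomorphic_intros holomorphic_deriv)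
  qed
qed

text \<open>The factor \<open>Re F\<close> is there for the components of the vector field \<open>cnj h' * b\<close>, which are real parts
  of holomorphic functions, see \<open>pulled_back_test_divergence\<close>.\<close>

lemma test_function_pullback:
  assumes "open A" "open B" and hol: "h holomorphic_on B" "F holomorphic_on B"
    and homeo: "homeomorphism A B \<phi> h" and \<psi>: "test_function_on A \<psi>"
  shows "test_function_on B (\<lambda>w. if w \<in> B then Re (F w) * \<psi> (h w) else 0)"
proof -
  let ?\<eta> = "\<lambda>w. if w \<in> B then Re (F w) * \<psi> (h w) else 0"
  define K where "K = \<phi> ` closure {x. \<psi> x \<noteq> 0}"
  have K0: "closure {x. \<psi> x \<noteq> 0} \<subseteq> A" "compact (closure {x. \<psi> x \<noteq> 0})"
    using \<psi> by (auto simp: test_function_on_def)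
  have K: "compact K" "K \<subseteq> B"
    unfolding K_def using K0 homeo
    by (auto simp: homeomorphism_def intro!: compact_continuous_image intro: continuous_on_subset)
  have sub: "{w. ?\<eta> w \<noteq> 0} \<subseteq> K"
  proof
    fix w assume "w \<in> {w. ?\<eta> w \<noteq> 0}"
    then have "w \<in> B" "\<psi> (h w) \<noteq> 0" by (auto split: if_splits)
    then have "h w \<in> closure {x. \<psi> x \<noteq> 0}" "\<phi> (h w) = w"
      using closure_subset[of "{x. \<psi> x \<noteq> 0}"] homeomorphism_apply2[OF homeo] by auto
    then show "w \<in> K" unfolding K_def by force
  qed
  have cl: "closure {w. ?\<eta> w \<noteq> 0} \<subseteq> K"
    using sub K(1) closure_minimal compact_imp_closed by blast
  have "Ck_on B k ?\<eta>" for k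
  proof (rule Ck_on_cong[OF \<open>open B\<close>])
    have "Ck_on A k \<psi>"
      using \<psi> Ck_on_subset[of UNIV k \<psi> A] by (simp add: test_function_on_def Ck_function_eq)
    moreover have "h ` B \<subseteq> A" using homeomorphism_image2[OF homeo] by simp
    ultimately have "Ck_on B k (\<lambda>w. \<psi> (h w))"
      using Ck_on_compose_holomorphic[OF \<open>open B\<close> hol(1)] by blast
    then show "Ck_on B k (\<lambda>w. Re (F w) * \<psi> (h w))"
      using Ck_on_mult[OF \<open>open B\<close> Ck_on_Re_holomorphic[OF \<open>open B\<close> hol(2)]] by blast
  qed auto
  moreover have "Ck_on (- K) k ?\<eta>" for k
  proof (rule Ck_on_cong[OF _ Ck_on_const[of _ k 0]])
    show "open (- K)" "open (- K)" using K(1) compact_imp_closed by blast+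
    show "0 = ?\<eta> x" if "x \<in> - K" for x
    proof -
      have "x \<notin> {w. ?\<eta> w \<noteq> 0}" using sub that by blast
      then show ?thesis unfolding mem_Collect_eq by (metis (full_types))
    qed
  qed
  ultimately have "Ck_on (B \<union> - K) k ?\<eta>" for k
    using Ck_on_Un[OF \<open>open B\<close> _ \<open>Ck_on B k ?\<eta>\<close>] K(1) compact_imp_closed by blast
  moreover have "B \<union> - K = UNIV" using K by auto
  ultimately have "Ck_function k ?\<eta>" for k by (simp add: Ck_function_eq)
  moreover have "compact (closure {w. ?\<eta> w \<noteq> 0})"
    using cl K(1) by (meson bounded_subset closed_closure compact_eq_bounded_closed)
  ultimately show ?thesis unfolding test_function_on_def using cl K(2) by blast
qed

section \<open>Bump functions and the fundamental lemma\<close>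

text \<open>The family \<open>x\<^bsup>-j\<^esup> exp (- 1 / x)\<close>, extended by zero to \<open>x \<le> 0\<close>, is closed under differentiation up
  to linear combinations, which makes smoothness an easy induction.\<close>

definition flat :: "nat \<Rightarrow> real \<Rightarrow> real" where
  "flat j x = (if x > 0 then exp (- (1 / x)) / x ^ j else 0)"

lemma flat_has_derivative:
  "(flat j has_field_derivative flat (j + 2) x - real j * flat (j + 1) x) (at x)"
proof -
  consider "x > 0" | "x < 0" | "x = 0" by linarith
  then show ?thesis
  proof cases
    case 1
    have "((\<lambda>x. exp (- (1 / x)) / x ^ j) has_field_derivative
        exp (- (1 / x)) / x ^ (j + 2) - real j * (exp (- (1 / x)) / x ^ (j + 1))) (at x)"
    proof (cases j)
      case 0
      then show ?thesis using 1 by (auto intro!: derivative_eq_intros simp: field_simps power2_eq_square)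
    next
      case (Suc i)
      have "x ^ i = x * x ^ (i - Suc 0)" if "i \<noteq> 0" using that by (cases i) auto
      then show ?thesis using 1 Suc
        by (auto intro!: derivative_eq_intros) (auto simp: field_simps)
    qed
    moreover have "\<forall>\<^sub>F y in nhds x. exp (- (1 / y)) / y ^ j = flat j y"
      by (rule eventually_nhds_in_open[of "{0<..}", THEN eventually_mono]) (use 1 in \<open>auto simp: flat_def\<close>)
    moreover have "exp (- (1 / x)) / x ^ (j + 2) = flat (j + 2) x" "exp (- (1 / x)) / x ^ (j + 1) = flat (j + 1) x"
      using 1 by (simp_all add: flat_def)
    ultimately show ?thesis
      using DERIV_cong_ev[OF refl, of "\<lambda>x. exp (- (1 / x)) / x ^ j" "flat j" x] by metis
  next
    case 2
    have "\<forall>\<^sub>F y in nhds x. 0 = flat j y"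
      by (rule eventually_nhds_in_open[of "{..<0}", THEN eventually_mono]) (use 2 in \<open>auto simp: flat_def\<close>)
    moreover have "((\<lambda>x. 0) has_field_derivative flat (j + 2) x - real j * flat (j + 1) x) (at x)"
      using 2 by (simp add: flat_def)
    ultimately show ?thesis using DERIV_cong_ev[OF refl, of "\<lambda>x. 0" "flat j" x] by blast
  next
    case 3
    \<comment> \<open>The difference quotient of \<open>flat j\<close> at 0 is \<open>flat (j + 1)\<close>.\<close>
    have "((\<lambda>y. flat (j + 1) y) \<longlongrightarrow> 0) (at_right 0)"
    proof (rule Lim_transform_eventually)
      show "((\<lambda>y. exp (- (1 / y)) / y ^ (j + 1)) \<longlongrightarrow> 0) (at_right (0::real))"
        by real_asymp
      show "\<forall>\<^sub>F y in at_right 0. exp (- (1 / y)) / y ^ (j + 1) = flat (j + 1) y"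
        by (auto simp: flat_def eventually_at_right_less intro: eventually_mono[OF eventually_at_right_less])
    qed
    moreover have "((\<lambda>y. flat (j + 1) y) \<longlongrightarrow> 0) (at_left 0)"
      by (rule Lim_transform_eventually[OF tendsto_const], rule eventually_at_leftI[of "-1"]) (auto simp: flat_def)
    ultimately have "(flat (j + 1) \<longlongrightarrow> 0) (at 0)"
      by (simp add: filterlim_at_split)
    moreover have "\<forall>\<^sub>F y in at 0. flat (j + 1) y = (flat j y - flat j 0) / (y - 0)"
      by (auto simp: flat_def eventually_at_filter field_simps)
    ultimately have "((\<lambda>y. (flat j y - flat j 0) / (y - 0)) \<longlongrightarrow> 0) (at 0)"
      by (rule Lim_transform_eventually)
    moreover have "flat i 0 = 0" for i by (simp add: flat_def)
    ultimately show ?thesis using 3 by (simp add: has_field_derivative_iff)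
  qed
qed

lemma Ck_on_flat:
  assumes S: "open S" and u: "\<And>n. Ck_on S n u"
  shows "Ck_on S n (\<lambda>z. flat j (u z))"
proof (induction n arbitrary: j)
  case 0
  have "continuous_on UNIV (flat j)"
    using flat_has_derivative DERIV_isCont continuous_at_imp_continuous_on by blast
  then show ?case using continuous_on_compose2[of UNIV "flat j" S u] u[of 0] by simp
next
  case (Suc n)
  show ?case
  proof (rule Ck_on_SucI[OF S])
    fix z assume z: "z \<in> S"
    have "(flat j has_derivative (\<lambda>h. (flat (j + 2) (u z) - real j * flat (j + 1) (u z)) * h)) (at (u z))"
      using flat_has_derivative has_field_derivative_def by blast
    from diff_chain_at[OF Ck_on_SucD[OF u z] this]
    show "((\<lambda>z. flat j (u z)) has_derivative (\<lambda>v. (flat (j + 2) (u z) + (- real j) * flat (j + 1) (u z)) *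
           frechet_derivative u (at z) v)) (at z)"
      by (simp add: o_def)
  next
    fix v
    have "Ck_on S n (\<lambda>x. frechet_derivative u (at x) v)" using u[of "Suc n"] by simp
    then show "Ck_on S n (\<lambda>z. (flat (j + 2) (u z) + (- real j) * flat (j + 1) (u z)) *
           frechet_derivative u (at z) v)"
      by (rule Ck_on_mult[OF S Ck_on_add[OF S Suc.IH Ck_on_mult[OF S Ck_on_const[OF S] Suc.IH]]])
  qed
qed

lemma flat_bounds: "0 \<le> flat 0 x" "flat 0 x \<le> 1"
  by (auto simp: flat_def)

text \<open>Scaling the argument instead of mollifying: the functions stay between 0 and 1 and increase to
  the indicator of the positive half-line.\<close>

lemma flat_scaled_tendsto:
  "(\<lambda>n. flat 0 (real n * x)) \<longlonglongrightarrow> (if x > 0 then 1 else 0)"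
proof (cases "x > 0")
  case True
  have "(\<lambda>n. exp (- (1 / (real n * x)))) \<longlonglongrightarrow> 1" using True by real_asymp
  then have "(\<lambda>n. flat 0 (real n * x)) \<longlonglongrightarrow> 1"
    by (rule Lim_transform_eventually) (use True in \<open>auto simp: flat_def eventually_sequentially intro!: exI[of _ 1]\<close>)
  then show ?thesis using True by simp
next
  case False
  then have "flat 0 (real n * x) = 0" for n
    by (auto simp: flat_def zero_less_mult_iff)
  then show ?thesis using False by simp
qed

definition box_bump :: "complex \<Rightarrow> complex \<Rightarrow> nat \<Rightarrow> complex \<Rightarrow> real" where
  "box_bump a b n z = flat 0 (real n * (Re z - Re a)) * flat 0 (real n * (Re b - Re z)) *
     (flat 0 (real n * (Im z - Im a)) * flat 0 (real n * (Im b - Im z)))"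

lemma box_bump_bound: "0 \<le> box_bump a b n z" "box_bump a b n z \<le> 1"
  unfolding box_bump_def by (intro mult_nonneg_nonneg mult_le_one flat_bounds)+

lemma box_bump_outside: "z \<notin> box a b \<Longrightarrow> box_bump a b n z = 0"
  by (auto simp: box_bump_def in_box_complex_iff flat_def zero_less_mult_iff)

lemma box_bump_tendsto: "(\<lambda>n. box_bump a b n z) \<longlonglongrightarrow> indicator (box a b) z"
proof -
  let ?c = "\<lambda>x::real. if x > 0 then 1 else 0 :: real"
  have "(\<lambda>n. box_bump a b n z) \<longlonglongrightarrow> ?c (Re z - Re a) * ?c (Re b - Re z) * (?c (Im z - Im a) * ?c (Im b - Im z))"
    unfolding box_bump_def by (intro tendsto_mult flat_scaled_tendsto)
  moreover have "?c (Re z - Re a) * ?c (Re b - Re z) * (?c (Im z - Im a) * ?c (Im b - Im z)) = indicator (box a b) z"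
    by (auto simp: indicator_def in_box_complex_iff)
  ultimately show ?thesis by simp
qed

lemma test_function_box_bump:
  assumes "cbox a b \<subseteq> \<Omega>"
  shows "test_function_on \<Omega> (box_bump a b n)"
proof -
  have aff: "Ck_on UNIV k (\<lambda>z. Re (c * z + d))" for c d k
    by (intro Ck_on_Re_holomorphic holomorphic_intros) auto
  have "Ck_on UNIV k (\<lambda>z::complex. flat 0 (Re (of_nat n * z + (- of_nat n * Re a))) *
       flat 0 (Re (- of_nat n * z + (of_nat n * Re b))) *
      (flat 0 (Re (- \<i> * of_nat n * z + (- of_nat n * Im a))) * 
       flat 0 (Re (\<i> * of_nat n * z + (of_nat n * Im b)))))" for k
    by (intro Ck_on_mult Ck_on_flat aff open_UNIV)
  then have "Ck_on UNIV k (box_bump a b n)" for k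
    unfolding box_bump_def[abs_def] by (simp add: algebra_simps)
  then have "Ck_function k (box_bump a b n)" for k by (simp add: Ck_function_eq)
  moreover have "{z. box_bump a b n z \<noteq> 0} \<subseteq> cbox a b"
    using box_bump_outside box_subset_cbox by blast
  then have "closure {z. box_bump a b n z \<noteq> 0} \<subseteq> cbox a b"
    by (simp add: closure_minimal closed_cbox)
  ultimately show ?thesis unfolding test_function_on_def
    using assms by (metis bounded_cbox bounded_subset closed_closure compact_eq_bounded_closed order_trans)
qed

text \<open>Box bumps converge boundedly to the indicator of a box, so \<open>u\<close> has integral zero over every closed
  box in \<open>\<Omega>\<close>; by Lebesgue differentiation it vanishes almost everywhere.\<close>

lemma fundamental_lemma_calculus_of_variations:
  fixes u :: "complex \<Rightarrow> real"
  assumes \<Omega>: "open \<Omega>" and u: "locally_summable_on \<Omega> u"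
    and zero: "\<And>\<psi>. test_function_on \<Omega> \<psi> \<Longrightarrow> (LINT z:\<Omega>|lebesgue. u z * \<psi> z) = 0"
  shows "AE z in lebesgue. z \<in> \<Omega> \<longrightarrow> u z = 0"
proof -
  \<comment> \<open>The bumps see only the open box; its boundary is a null set.\<close>
  have box0: "integral (cbox a b) u = 0" if ab: "cbox a b \<subseteq> \<Omega>" for a b
  proof -
    have int: "set_integrable lebesgue (cbox a b) u"
      using u ab by (simp add: locally_summable_on_def)
    have eq: "(LINT z:\<Omega>|lebesgue. u z * box_bump a b n z) =
        (LINT z|lebesgue. (indicator (cbox a b) z * u z) * box_bump a b n z)" for n
      unfolding set_lebesgue_integral_def
      by (rule Bochner_Integration.integral_cong)
         (use ab box_subset_cbox[of a b] box_bump_outside[of _ a b n] in \<open>auto simp: indicator_def\<close>)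
    have meas: "box_bump a b n \<in> borel_measurable lebesgue" for n
    proof -
      have "continuous_on UNIV (box_bump a b n)"
        using test_function_box_bump[OF ab, of n] Ck_function.simps(1) by (auto simp: test_function_on_def simp del: Ck_function.simps)
      then show ?thesis
        by (simp add: borel_measurable_continuous_onI measurable_completion)
    qed
    have lim: "(\<lambda>n. LINT z|lebesgue. (indicator (cbox a b) z * u z) * box_bump a b n z)
       \<longlonglongrightarrow> (LINT z|lebesgue. (indicator (cbox a b) z * u z) * indicator (box a b) z)"
    proof (rule integral_dominated_convergence[where w="\<lambda>z. norm (indicator (cbox a b) z * u z)"])
      have I: "integrable lebesgue (\<lambda>z. indicator (cbox a b) z * u z)"
        using int by (simp add: set_integrable_def)
      then show "integrable lebesgue (\<lambda>z. norm (indicator (cbox a b) z * u z))" by simp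
      show "(\<lambda>z. (indicator (cbox a b) z * u z) * indicator (box a b) z) \<in> borel_measurable lebesgue"
        by (rule borel_measurable_times[OF borel_measurable_integrable[OF I]]) (simp add: borel_measurable_indicator)
      show "(\<lambda>z. (indicator (cbox a b) z * u z) * box_bump a b n z) \<in> borel_measurable lebesgue" for n
        by (rule borel_measurable_times[OF borel_measurable_integrable[OF I] meas])
      show "AE z in lebesgue. (\<lambda>n. (indicator (cbox a b) z * u z) * box_bump a b n z)
         \<longlonglongrightarrow> (indicator (cbox a b) z * u z) * indicator (box a b) z"
        by (intro AE_I2 tendsto_mult tendsto_const box_bump_tendsto)
      show "AE z in lebesgue. norm ((indicator (cbox a b) z * u z) * box_bump a b n z)
          \<le> norm (indicator (cbox a b) z * u z)" for n
      proof (rule AE_I2)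
        fix z
        have "\<bar>box_bump a b n z\<bar> \<le> 1" using box_bump_bound[of a b n z] by simp
        then show "norm ((indicator (cbox a b) z * u z) * box_bump a b n z) \<le> norm (indicator (cbox a b) z * u z)"
          by (simp add: abs_mult mult_left_le)
      qed
    qed
    have "(LINT z|lebesgue. (indicator (cbox a b) z * u z) * box_bump a b n z) = 0" for n
      using zero[OF test_function_box_bump[OF ab, of n]] eq[of n] by simp
    note Z = this
    have "(LINT z|lebesgue. (indicator (cbox a b) z * u z) * indicator (box a b) z) = 0"
      using lim[unfolded Z LIMSEQ_const_iff, symmetric] .
    moreover have "(LINT z|lebesgue. (indicator (cbox a b) z * u z) * indicator (box a b) z) =
       (LINT z:box a b|lebesgue. u z)"
      unfolding set_lebesgue_integral_def
      by (rule Bochner_Integration.integral_cong) (use box_subset_cbox[of a b] in \<open>auto simp: indicator_def\<close>)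
    moreover have "set_integrable lebesgue (box a b) u"
      by (rule set_integrable_subset[OF int]) (auto simp: box_subset_cbox)
    ultimately have "integral (box a b) u = 0"
      by (simp add: set_lebesgue_integral_eq_integral)
    then show ?thesis by (simp add: integral_open_interval)
  qed
  have loc: "negligible {z \<in> box a b. u z \<noteq> 0}" if ab: "cbox a b \<subseteq> \<Omega>" for a b
  proof -
    define v where "v z = (if z \<in> cbox a b then u z else 0)" for z
    have "v integrable_on UNIV"
      using u ab unfolding v_def locally_summable_on_def
      by (simp add: integrable_restrict_UNIV set_lebesgue_integral_eq_integral(1))
    then have "v integrable_on cbox c d" for c d
      using integrable_on_subcbox by blast
    from integrable_ccontinuous_explicit[OF this]
    obtain N where N: "negligible N" and lim: "\<And>x e. x \<notin> N \<Longrightarrow> 0 < e \<Longrightarrow> \<exists>d>0. \<forall>h. 0 < h \<and> h < d \<longrightarrow>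
       norm (integral (cbox x (x + h *\<^sub>R One)) v /\<^sub>R h ^ DIM(complex) - v x) < e" by metis
    have "u z = 0" if z: "z \<in> box a b" "z \<notin> N" for z
    proof (rule ccontr)
      assume "u z \<noteq> 0"
      obtain r where r: "r > 0" "ball z r \<subseteq> box a b"
        using z openE[OF open_box] by blast
      obtain d where d: "d > 0" "\<And>h. 0 < h \<Longrightarrow> h < d \<Longrightarrow>
         norm (integral (cbox z (z + h *\<^sub>R One)) v /\<^sub>R h ^ DIM(complex) - v z) < norm (u z)"
        using lim[OF z(2), of "norm (u z)"] \<open>u z \<noteq> 0\<close> by auto
      define h where "h = min d r / 4"
      have h: "0 < h" "h < d" "2 * h < r" using d(1) r(1) by (auto simp: h_def)
      have sub: "cbox z (z + h *\<^sub>R One) \<subseteq> ball z r"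
      proof
        fix w assume "w \<in> cbox z (z + h *\<^sub>R One)"
        then have "\<bar>Re (w - z)\<bar> \<le> h" "\<bar>Im (w - z)\<bar> \<le> h"
          by (auto simp: in_cbox_complex_iff Basis_complex_def)
        then have "cmod (w - z) \<le> 2 * h" using cmod_le[of "w - z"] by linarith
        then show "w \<in> ball z r" using h(3) by (simp add: dist_norm norm_minus_commute)
      qed
      have sub': "cbox z (z + h *\<^sub>R One) \<subseteq> cbox a b"
        using sub r(2) box_subset_cbox[of a b] by blast
      then have "integral (cbox z (z + h *\<^sub>R One)) v = integral (cbox z (z + h *\<^sub>R One)) u"
        by (intro Henstock_Kurzweil_Integration.integral_cong) (auto simp: v_def)
      also have "\<dots> = 0" using box0 sub' ab by blast
      finally have "norm (v z) < norm (u z)" using d(2)[OF h(1,2)] by simp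
      moreover have "v z = u z" using z(1) box_subset_cbox[of a b] by (auto simp: v_def)
      ultimately show False by simp
    qed
    then have "{z \<in> box a b. u z \<noteq> 0} \<subseteq> N" by blast
    then show ?thesis using N negligible_subset by blast
  qed
  have "negligible {z \<in> \<Omega>. u z \<noteq> 0}"
  proof -
    define F where "F = {box a b | a b :: complex. cbox a b \<subseteq> \<Omega>}"
    have "\<Union>F = \<Omega>"
    proof (intro equalityI subsetI)
      fix z assume "z \<in> \<Omega>"
      then obtain a b where "z \<in> box a b" "cbox a b \<subseteq> \<Omega>"
        using open_contains_cbox[of \<Omega> z] \<Omega> by (metis open_contains_cbox)
      then show "z \<in> \<Union>F" by (auto simp: F_def)
    qed (use box_subset_cbox in \<open>fastforce simp: F_def\<close>)
    moreover obtain F' where "F' \<subseteq> F" "countable F'" "\<Union>F' = \<Union>F"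
      using Lindelof[of F] by (auto simp: F_def)
    ultimately have "{z \<in> \<Omega>. u z \<noteq> 0} = (\<Union>B\<in>F'. {z \<in> B. u z \<noteq> 0})" by blast
    moreover have "negligible {z \<in> B. u z \<noteq> 0}" if "B \<in> F'" for B
      using loc that \<open>F' \<subseteq> F\<close> by (auto simp: F_def)
    ultimately show ?thesis
      using negligible_countable_Union[of "(\<lambda>B. {z \<in> B. u z \<noteq> 0}) ` F'"] \<open>countable F'\<close> by auto
  qed
  then show ?thesis by (simp add: AE_iff_null_sets eventually_ae_filter negligible_iff_null_sets) (auto)
qed

section \<open>Locally summable functions and uniqueness of weak gradients\<close>

lemma set_integrable_continuous_mult:
  fixes u v :: "'a::euclidean_space \<Rightarrow> real"
  assumes K: "compact K" and v: "continuous_on K v" and u: "set_integrable lebesgue K u"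
  shows "set_integrable lebesgue K (\<lambda>z. v z * u z)"
proof -
  obtain M where M: "\<And>z. z \<in> K \<Longrightarrow> norm (v z) \<le> M"
    using compact_imp_bounded[OF compact_continuous_image[OF v K]] by (auto simp: bounded_iff)
  have eq: "(\<lambda>z. indicator K z *\<^sub>R (v z * u z)) = (\<lambda>z. (indicator K z *\<^sub>R v z) * (indicator K z *\<^sub>R u z))"
    by (auto simp: indicator_def)
  have "(\<lambda>z. indicator K z *\<^sub>R v z) \<in> borel_measurable borel"
    using borel_measurable_continuous_on_indicator[OF _ v] compact_imp_closed[OF K] by auto
  then have mv: "(\<lambda>z. indicator K z *\<^sub>R v z) \<in> borel_measurable lebesgue"
    by (intro measurable_completion) simp
  have iu: "integrable lebesgue (\<lambda>z. indicator K z *\<^sub>R u z)" using u by (simp add: set_integrable_def)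
  show ?thesis unfolding set_integrable_def eq
  proof (rule Bochner_Integration.integrable_bound)
    show "integrable lebesgue (\<lambda>z. M * (indicator K z *\<^sub>R u z))"
      using iu by (intro integrable_mult_right) auto
    show "(\<lambda>z. (indicator K z *\<^sub>R v z) * (indicator K z *\<^sub>R u z)) \<in> borel_measurable lebesgue"
      by (rule borel_measurable_times[OF mv borel_measurable_integrable[OF iu]])
    show "AE z in lebesgue. norm ((indicator K z *\<^sub>R v z) * (indicator K z *\<^sub>R u z)) \<le> norm (M * (indicator K z *\<^sub>R u z))"
    proof (rule AE_I2)
      fix z
      show "norm ((indicator K z *\<^sub>R v z) * (indicator K z *\<^sub>R u z)) \<le> norm (M * (indicator K z *\<^sub>R u z))"
      proof (cases "z \<in> K")
        case True
        then have "\<bar>v z\<bar> \<le> \<bar>M\<bar>" using M[of z] by simp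
        then show ?thesis using True by (simp add: abs_mult mult_right_mono)
      qed simp
    qed
  qed
qed

lemma locally_summable_continuous_mult:
  fixes u v :: "'a::euclidean_space \<Rightarrow> real"
  assumes "locally_summable_on \<Omega> u" "continuous_on \<Omega> v"
  shows "locally_summable_on \<Omega> (\<lambda>z. v z * u z)"
  unfolding locally_summable_on_def
proof (intro allI impI, elim conjE)
  fix K assume K: "compact K" "K \<subseteq> \<Omega>"
  show "set_integrable lebesgue K (\<lambda>z. v z * u z)"
    by (rule set_integrable_continuous_mult[OF K(1) continuous_on_subset[OF assms(2) K(2)]])
      (use assms(1) K in \<open>auto simp: locally_summable_on_def\<close>)
qed

lemma locally_summable_continuous:
  fixes v :: "'a::euclidean_space \<Rightarrow> real"
  assumes "continuous_on \<Omega> v" shows "locally_summable_on \<Omega> v"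
proof -
  have "set_integrable lebesgue K (\<lambda>z. 1 :: real)" if "compact K" for K :: "'a set"
    using lmeasurable_compact[OF that] by (simp add: set_integrable_def lmeasurable_iff_integrable)
  then have "locally_summable_on \<Omega> (\<lambda>z. 1 :: real)" by (simp add: locally_summable_on_def)
  from locally_summable_continuous_mult[OF this assms] show ?thesis by simp
qed

lemma locally_summable_add:
  fixes u v :: "'a::euclidean_space \<Rightarrow> real"
  shows "locally_summable_on \<Omega> u \<Longrightarrow> locally_summable_on \<Omega> v \<Longrightarrow> locally_summable_on \<Omega> (\<lambda>z. u z + v z)"
  by (simp add: locally_summable_on_def set_integral_add(1))

lemma locally_summable_complex_iff:
  fixes g :: "'a::euclidean_space \<Rightarrow> complex"
  shows "locally_summable_on \<Omega> g \<longleftrightarrow>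
    locally_summable_on \<Omega> (\<lambda>z. Re (g z)) \<and> locally_summable_on \<Omega> (\<lambda>z. Im (g z))"
proof -
  have "set_integrable lebesgue K g \<longleftrightarrow>
      set_integrable lebesgue K (\<lambda>z. Re (g z)) \<and> set_integrable lebesgue K (\<lambda>z. Im (g z))" for K
    using absolutely_integrable_componentwise_iff[where f=g and A=K] by (simp add: Basis_complex_def)
  then show ?thesis unfolding locally_summable_on_def by blast
qed

lemma locally_summable_compact_support:
  fixes u :: "'a::euclidean_space \<Rightarrow> real"
  assumes u: "locally_summable_on \<Omega> u" and K: "compact K" "K \<subseteq> \<Omega>"
    and 0: "\<And>z. z \<in> \<Omega> \<Longrightarrow> z \<notin> K \<Longrightarrow> u z = 0"
  shows "set_integrable lebesgue \<Omega> u"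
proof -
  have "set_integrable lebesgue K u" using u K by (auto simp: locally_summable_on_def)
  moreover have "(\<lambda>z. indicator \<Omega> z *\<^sub>R u z) = (\<lambda>z. indicator K z *\<^sub>R u z)"
    using K(2) 0 by (intro ext) (auto simp: indicator_def)
  ultimately show ?thesis unfolding set_integrable_def by simp
qed

lemma locally_summable_measurable:
  fixes u :: "'a::euclidean_space \<Rightarrow> real"
  assumes \<Omega>: "open \<Omega>" and u: "locally_summable_on \<Omega> u"
  shows "(\<lambda>z. indicator \<Omega> z * u z) \<in> borel_measurable lebesgue"
proof -
  obtain C where C: "\<And>n. compact (C n)" "\<And>n. C n \<subseteq> \<Omega>"
       "\<And>n. C n \<subseteq> interior (C (Suc n))" "\<Union>(range C) = \<Omega>"
       "\<And>K. compact K \<Longrightarrow> K \<subseteq> \<Omega> \<Longrightarrow> \<exists>N. \<forall>n\<ge>N. K \<subseteq> C n"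
    using open_Union_compact_subsets[OF \<Omega>] by metis
  show ?thesis
  proof (rule borel_measurable_LIMSEQ_real)
    show "(\<lambda>z. indicator (C n) z * u z) \<in> borel_measurable lebesgue" for n
      using u C(1,2)[of n] borel_measurable_integrable
      by (fastforce simp: locally_summable_on_def set_integrable_def)
    show "(\<lambda>n. indicator (C n) z * u z) \<longlonglongrightarrow> indicator \<Omega> z * u z" for z
    proof (cases "z \<in> \<Omega>")
      case True
      then obtain N where "\<forall>n\<ge>N. {z} \<subseteq> C n" using C(5)[of "{z}"] by auto
      then have "\<forall>\<^sub>F n in sequentially. indicator (C n) z * u z = indicator \<Omega> z * u z"
        using True unfolding eventually_sequentially by (intro exI[of _ N]) auto
      then show ?thesis by (rule tendsto_eventually)
    next
      case False
      then have "z \<notin> C n" for n using C(2) by blast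
      then show ?thesis using False by simp
    qed
  qed
qed

lemma test_functionD:
  assumes "test_function_on \<Omega> \<psi>"
  shows "continuous_on UNIV \<psi>" and "(\<psi> has_derivative frechet_derivative \<psi> (at z)) (at z)"
    and "continuous_on UNIV (\<lambda>z. frechet_derivative \<psi> (at z) v)"
    and "compact (closure {z. \<psi> z \<noteq> 0})" "closure {z. \<psi> z \<noteq> 0} \<subseteq> \<Omega>"
    and "z \<notin> closure {z. \<psi> z \<noteq> 0} \<Longrightarrow> \<psi> z = 0"
    and "z \<notin> closure {z. \<psi> z \<noteq> 0} \<Longrightarrow> frechet_derivative \<psi> (at z) v = 0"
proof -
  have C0: "Ck_function 0 \<psi>" and C1: "Ck_function (Suc 0) \<psi>"
    using assms unfolding test_function_on_def by blast+
  show "continuous_on UNIV \<psi>" using C0 by simp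
  show d: "(\<psi> has_derivative frechet_derivative \<psi> (at z)) (at z)" for z
    using C1 by (simp add: frechet_derivative_works)
  show "continuous_on UNIV (\<lambda>z. frechet_derivative \<psi> (at z) v)" using C1 by simp
  show "compact (closure {z. \<psi> z \<noteq> 0})" "closure {z. \<psi> z \<noteq> 0} \<subseteq> \<Omega>"
    using assms by (auto simp: test_function_on_def)
  show z0: "z \<notin> closure {z. \<psi> z \<noteq> 0} \<Longrightarrow> \<psi> z = 0" for z
    using closure_subset[of "{z. \<psi> z \<noteq> 0}"] by auto
  assume z: "z \<notin> closure {z. \<psi> z \<noteq> 0}"
  have "((\<lambda>z. 0) has_derivative frechet_derivative \<psi> (at z)) (at z)"
  proof (rule has_derivative_transform_within_open[OF d])
    show "open (- closure {z. \<psi> z \<noteq> 0})" by blast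
    show "z \<in> - closure {z. \<psi> z \<noteq> 0}" using z by blast
    show "\<psi> w = 0" if "w \<in> - closure {z. \<psi> z \<noteq> 0}" for w
      by (rule z0) (use that in blast)
  qed
  from has_derivative_unique[OF this has_derivative_const]
  have "frechet_derivative \<psi> (at z) = (\<lambda>v. 0)" .
  then show "frechet_derivative \<psi> (at z) v = 0" by simp
qed

lemma integrable_times_test:
  assumes "locally_summable_on \<Omega> u" "test_function_on \<Omega> \<psi>"
  shows "set_integrable lebesgue \<Omega> (\<lambda>z. u z * \<psi> z)"
    "set_integrable lebesgue \<Omega> (\<lambda>z. u z * frechet_derivative \<psi> (at z) v)"
proof -
  note t = test_functionD[OF assms(2)]
  have l: "locally_summable_on \<Omega> (\<lambda>z. \<psi> z * u z)"
       "locally_summable_on \<Omega> (\<lambda>z. frechet_derivative \<psi> (at z) v * u z)"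
    by (rule locally_summable_continuous_mult[OF assms(1) continuous_on_subset[OF t(1) subset_UNIV]],
        rule locally_summable_continuous_mult[OF assms(1) continuous_on_subset[OF t(3) subset_UNIV]])
  have "set_integrable lebesgue \<Omega> (\<lambda>z. \<psi> z * u z)"
  proof (rule locally_summable_compact_support[OF l(1) t(4,5)])
    show "\<psi> z * u z = 0" if "z \<notin> closure {z. \<psi> z \<noteq> 0}" for z
      by (simp only: t(6)[OF that] mult_zero_left)
  qed
  moreover have "set_integrable lebesgue \<Omega> (\<lambda>z. frechet_derivative \<psi> (at z) v * u z)"
  proof (rule locally_summable_compact_support[OF l(2) t(4,5)])
    show "frechet_derivative \<psi> (at z) v * u z = 0" if "z \<notin> closure {z. \<psi> z \<noteq> 0}" for z
      by (simp only: t(7)[OF that] mult_zero_left)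
  qed
  ultimately show "set_integrable lebesgue \<Omega> (\<lambda>z. u z * \<psi> z)"
    "set_integrable lebesgue \<Omega> (\<lambda>z. u z * frechet_derivative \<psi> (at z) v)"
    by (simp_all add: mult.commute)
qed

lemma has_weak_gradient_onD:
  assumes "has_weak_gradient_on f g \<Omega>"
  shows "locally_summable_on \<Omega> g"
    and "\<And>\<psi> b. test_function_on \<Omega> \<psi> \<Longrightarrow> b \<in> Basis \<Longrightarrow>
      (LINT x:\<Omega>|lebesgue. f x * frechet_derivative \<psi> (at x) b) = - (LINT x:\<Omega>|lebesgue. (g x \<bullet> b) * \<psi> x)"
  using assms by (simp_all add: has_weak_gradient_on_def)

lemma weak_gradient_unique:
  fixes g1 g2 :: "complex \<Rightarrow> complex"
  assumes \<Omega>: "open \<Omega>" and g: "has_weak_gradient_on f g1 \<Omega>" "has_weak_gradient_on f g2 \<Omega>"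
  shows "AE z in lebesgue. z \<in> \<Omega> \<longrightarrow> g1 z = g2 z"
proof -
  have ls: "locally_summable_on \<Omega> (\<lambda>z. g z \<bullet> b)" if "has_weak_gradient_on f g \<Omega>" for g and b :: complex
    unfolding locally_summable_on_def
  proof (intro allI impI)
    fix K assume "compact K \<and> K \<subseteq> \<Omega>"
    then have "set_integrable lebesgue K g"
      using that by (simp add: has_weak_gradient_on_def locally_summable_on_def)
    then show "set_integrable lebesgue K (\<lambda>z. g z \<bullet> b)" by (rule absolutely_integrable_component)
  qed
  have AE: "AE z in lebesgue. z \<in> \<Omega> \<longrightarrow> g1 z \<bullet> b + (-1) * (g2 z \<bullet> b) = 0" if b: "b \<in> Basis" for b
  proof (rule fundamental_lemma_calculus_of_variations[OF \<Omega>])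
    show "locally_summable_on \<Omega> (\<lambda>z. g1 z \<bullet> b + (-1) * (g2 z \<bullet> b))"
      by (rule locally_summable_add[OF ls[OF g(1)]
            locally_summable_continuous_mult[OF ls[OF g(2)] continuous_on_const]])
    fix \<psi> assume \<psi>: "test_function_on \<Omega> \<psi>"
    note i = integrable_times_test(1)[OF ls[OF g(1)] \<psi>, of b] integrable_times_test(1)[OF ls[OF g(2)] \<psi>, of b]
    have e: "(LINT z:\<Omega>|lebesgue. (g1 z \<bullet> b) * \<psi> z) = (LINT z:\<Omega>|lebesgue. (g2 z \<bullet> b) * \<psi> z)"
      using has_weak_gradient_onD(2)[OF g(1) \<psi> b] has_weak_gradient_onD(2)[OF g(2) \<psi> b] by linarith
    have "(LINT z:\<Omega>|lebesgue. (g1 z \<bullet> b + (-1) * (g2 z \<bullet> b)) * \<psi> z) =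
       (LINT z:\<Omega>|lebesgue. (g1 z \<bullet> b) * \<psi> z - (g2 z \<bullet> b) * \<psi> z)"
      by (simp add: left_diff_distrib)
    also have "\<dots> = 0" using set_integral_diff(2)[OF i] e by linarith
    finally show "(LINT z:\<Omega>|lebesgue. (g1 z \<bullet> b + (-1) * (g2 z \<bullet> b)) * \<psi> z) = 0" .
  qed
  have "1 \<in> (Basis :: complex set)" "\<i> \<in> (Basis :: complex set)" by (simp_all add: Basis_complex_def)
  from AE[OF this(1)] AE[OF this(2)] show ?thesis
    by eventually_elim (simp add: complex_eq_iff)
qed

lemma has_weak_gradient_weak_gradient:
  "has_weak_gradient_on f g \<Omega> \<Longrightarrow> has_weak_gradient_on f (weak_gradient \<Omega> f) \<Omega>"
  unfolding weak_gradient_def by (rule someI[where P="\<lambda>g. has_weak_gradient_on f g \<Omega>"])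

lemma weak_gradient_AE:
  fixes g :: "complex \<Rightarrow> complex"
  assumes "open \<Omega>" "has_weak_gradient_on f g \<Omega>"
  shows "AE z in lebesgue. z \<in> \<Omega> \<longrightarrow> weak_gradient \<Omega> f z = g z"
  by (rule weak_gradient_unique[OF assms(1) has_weak_gradient_weak_gradient[OF assms(2)] assms(2)])

text \<open>Thus Sobolev seminorms may be computed with any weak gradient at hand.\<close>

lemma weak_gradient_integral:
  fixes g :: "complex \<Rightarrow> complex"
  assumes \<Omega>: "open \<Omega>" and g: "has_weak_gradient_on f g \<Omega>"
  shows "set_integrable lebesgue \<Omega> (\<lambda>z. norm (weak_gradient \<Omega> f z) powr p) \<longleftrightarrow>
           set_integrable lebesgue \<Omega> (\<lambda>z. norm (g z) powr p)"
    and "(LINT z:\<Omega>|lebesgue. norm (weak_gradient \<Omega> f z) powr p) = (LINT z:\<Omega>|lebesgue. norm (g z) powr p)"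
proof -
  have g': "has_weak_gradient_on f (weak_gradient \<Omega> f) \<Omega>"
    by (rule has_weak_gradient_weak_gradient[OF g])
  have m: "(\<lambda>z. indicator \<Omega> z *\<^sub>R norm (k z) powr p) \<in> borel_measurable lebesgue"
    if "has_weak_gradient_on f k \<Omega>" for k
  proof -
    have "locally_summable_on \<Omega> (\<lambda>z. Re (k z))" "locally_summable_on \<Omega> (\<lambda>z. Im (k z))"
      using has_weak_gradient_onD(1)[OF that] by (simp_all add: locally_summable_complex_iff)
    then have [measurable]: "(\<lambda>z. indicator \<Omega> z * Re (k z)) \<in> borel_measurable lebesgue"
        "(\<lambda>z. indicator \<Omega> z * Im (k z)) \<in> borel_measurable lebesgue"
      by (auto intro: locally_summable_measurable[OF \<Omega>])
    have [measurable]: "\<Omega> \<in> sets lebesgue" using \<Omega> by auto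
    have "(\<lambda>z. indicator \<Omega> z * (sqrt ((indicator \<Omega> z * Re (k z))\<^sup>2 + (indicator \<Omega> z * Im (k z))\<^sup>2)) powr p)
        \<in> borel_measurable lebesgue" by measurable
    also have "(\<lambda>z. indicator \<Omega> z * (sqrt ((indicator \<Omega> z * Re (k z))\<^sup>2 + (indicator \<Omega> z * Im (k z))\<^sup>2)) powr p)
       = (\<lambda>z. indicator \<Omega> z *\<^sub>R norm (k z) powr p)"
      by (auto simp: indicator_def cmod_def)
    finally show ?thesis .
  qed
  have AE: "AE z in lebesgue. indicator \<Omega> z *\<^sub>R norm (weak_gradient \<Omega> f z) powr p = indicator \<Omega> z *\<^sub>R norm (g z) powr p"
    using weak_gradient_AE[OF assms] by eventually_elim (auto simp: indicator_def)
  show "set_integrable lebesgue \<Omega> (\<lambda>z. norm (weak_gradient \<Omega> f z) powr p) \<longleftrightarrow>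
           set_integrable lebesgue \<Omega> (\<lambda>z. norm (g z) powr p)"
    unfolding set_integrable_def by (rule integrable_cong_AE[OF m[OF g'] m[OF g] AE])
  show "(LINT z:\<Omega>|lebesgue. norm (weak_gradient \<Omega> f z) powr p) = (LINT z:\<Omega>|lebesgue. norm (g z) powr p)"
    unfolding set_lebesgue_integral_def by (rule integral_cong_AE[OF m[OF g'] m[OF g] AE])
qed

section \<open>The weak gradient of a composition with a conformal map\<close>

lemma biholomorphic_derivs:
  assumes A: "open A" "\<phi> holomorphic_on A" and hom: "homeomorphism A B \<phi> h"
  shows "open B" "h holomorphic_on B"
    and "\<And>z. z \<in> A \<Longrightarrow> deriv \<phi> z \<noteq> 0"
    and "\<And>w. w \<in> B \<Longrightarrow> deriv h w * deriv \<phi> (h w) = 1"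
    and "inj_on \<phi> A" "inj_on h B"
proof -
  show inj: "inj_on \<phi> A" using hom by (metis homeomorphism_apply1 inj_onI)
  show "inj_on h B" using hom by (metis homeomorphism_apply2 inj_onI)
  show nz: "deriv \<phi> z \<noteq> 0" if "z \<in> A" for z
    using holomorphic_injective_imp_regular[OF A(2,1) inj that] .
  have im: "\<phi> ` A = B" "h ` B = A" using hom by (auto simp: homeomorphism_def)
  show B: "open B" using open_mapping_thm3[OF A(2,1) inj] im by simp
  have der: "(h has_field_derivative inverse (deriv \<phi> (h w))) (at w)" if w: "w \<in> B" for w
  proof -
    have hw: "h w \<in> A" using w im by blast
    show ?thesis
    proof (rule has_field_derivative_inverse_basic[where g=h and f=\<phi> and t=B])
      show "(\<phi> has_field_derivative deriv \<phi> (h w)) (at (h w))" using A hw holomorphic_derivI by blast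
      show "deriv \<phi> (h w) \<noteq> 0" by (rule nz[OF hw])
      show "continuous (at w) h"
        using hom w B by (simp add: continuous_on_eq_continuous_at homeomorphism_def)
      show "\<And>z. z \<in> B \<Longrightarrow> \<phi> (h z) = z" using hom by (simp add: homeomorphism_def)
    qed (use B w in auto)
  qed
  show "h holomorphic_on B"
    using der B by (meson holomorphic_on_open)
  show "deriv h w * deriv \<phi> (h w) = 1" if "w \<in> B" for w
  proof -
    have "h w \<in> A" using that im by blast
    then show ?thesis using DERIV_imp_deriv[OF der[OF that]] nz by simp
  qed
qed

text \<open>On compact subsets of \<open>A\<close> the Jacobian \<open>|\<phi>'|\<^sup>2\<close> is bounded away from zero.\<close>

lemma locally_summable_pullback:
  fixes f :: "complex \<Rightarrow> real"
  assumes A: "open A" "\<phi> holomorphic_on A" and hom: "homeomorphism A B \<phi> h"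
    and f: "locally_summable_on B f"
  shows "locally_summable_on A (\<lambda>z. f (\<phi> z))"
proof -
  note bi = biholomorphic_derivs[OF A hom]
  have "locally_summable_on A (\<lambda>z. (cmod (deriv \<phi> z))\<^sup>2 * f (\<phi> z))"
    unfolding locally_summable_on_def
  proof (intro allI impI, elim conjE)
    fix K assume K: "compact K" "K \<subseteq> A"
    have "continuous_on K \<phi>"
      using holomorphic_on_imp_continuous_on[OF A(2)] K(2) continuous_on_subset by blast
    then have "compact (\<phi> ` K)" using K(1) compact_continuous_image by blast
    moreover have "\<phi> ` K \<subseteq> B" using K(2) homeomorphism_image1[OF hom] by blast
    ultimately have "set_integrable lebesgue (\<phi> ` K) f" using f by (simp add: locally_summable_on_def)
    moreover have "K \<in> sets lebesgue" using lmeasurable_compact[OF K(1)] by (simp add: fmeasurable_def)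
    ultimately show "set_integrable lebesgue K (\<lambda>z. (cmod (deriv \<phi> z))\<^sup>2 * f (\<phi> z))"
      using holomorphic_change_of_variables(1)[OF _ K(2) A bi(5)] by blast
  qed
  moreover have "continuous_on A (\<lambda>z. inverse ((cmod (deriv \<phi> z))\<^sup>2))"
    using bi(3) by (intro continuous_intros holomorphic_on_imp_continuous_on holomorphic_deriv A) auto
  ultimately have "locally_summable_on A (\<lambda>z. inverse ((cmod (deriv \<phi> z))\<^sup>2) * ((cmod (deriv \<phi> z))\<^sup>2 * f (\<phi> z)))"
    by (rule locally_summable_continuous_mult)
  moreover have "set_integrable lebesgue K (\<lambda>z. inverse ((cmod (deriv \<phi> z))\<^sup>2) * ((cmod (deriv \<phi> z))\<^sup>2 * f (\<phi> z)))
      \<longleftrightarrow> set_integrable lebesgue K (\<lambda>z. f (\<phi> z))" if "K \<subseteq> A" for K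
    unfolding set_integrable_def
    by (rule Bochner_Integration.integrable_cong) (use that bi(3) in \<open>auto simp: indicator_def\<close>)
  ultimately show ?thesis unfolding locally_summable_on_def by meson
qed

text \<open>The vector field \<open>w \<mapsto> cnj (h' w) * b\<close> is divergence free, being the conjugate of a holomorphic function.
  Its components are the factors of \<open>\<psi> \<circ> h\<close> in \<open>\<eta> 1\<close> and \<open>\<eta> \<i>\<close>. The divergence of its product with
  \<open>\<psi> \<circ> h\<close> therefore contains no second derivative of \<open>h\<close>, and it is the push-forward of the directional
  derivative of \<open>\<psi>\<close>, with exactly the Jacobian factor that the change of variables produces.\<close>

lemma pulled_back_test_divergence:
  fixes h \<psi> b
  assumes A: "open A" and B: "open B" and h: "h holomorphic_on B" and hom: "homeomorphism A B \<phi> h"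
    and \<psi>: "test_function_on A \<psi>"
  defines "\<eta> \<equiv> \<lambda>c w. if w \<in> B then Re (c * deriv h w * cnj b) * \<psi> (h w) else 0"
  assumes w: "w \<in> B"
  shows "frechet_derivative (\<eta> 1) (at w) 1 + frechet_derivative (\<eta> \<i>) (at w) \<i>
    = (cmod (deriv h w))\<^sup>2 * frechet_derivative \<psi> (at (h w)) b"
proof -
  let ?D = "frechet_derivative \<psi> (at (h w))"
  note t = test_functionD[OF \<psi>]
  have lin: "linear ?D" using t(2) has_derivative_linear by blast
  have der: "(\<eta> c has_derivative (\<lambda>v. Re (c * deriv h w * cnj b) * ?D (deriv h w * v) +
      Re (c * (deriv (deriv h) w * v) * cnj b) * \<psi> (h w))) (at w)" for c
  proof -
    have h1: "(h has_derivative (*) (deriv h w)) (at w)"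
      using holomorphic_derivI[OF h B w] by (simp add: has_field_derivative_def)
    have h2: "(deriv h has_derivative (*) (deriv (deriv h) w)) (at w)"
      using holomorphic_derivI[OF holomorphic_deriv[OF h B] B w] by (simp add: has_field_derivative_def)
    have d1: "((\<lambda>w. \<psi> (h w)) has_derivative (\<lambda>v. ?D (deriv h w * v))) (at w)"
      using diff_chain_at[OF h1 t(2)] by (simp add: o_def)
    have d2: "((\<lambda>w. Re (c * deriv h w * cnj b)) has_derivative (\<lambda>v. Re (c * (deriv (deriv h) w * v) * cnj b))) (at w)"
      by (intro has_derivative_Re has_derivative_mult_left has_derivative_mult_right h2)
    show ?thesis
      by (rule has_derivative_transform_within_open[OF has_derivative_mult[OF d2 d1] B w]) (simp add: \<eta>_def)
  qed
  have fr: "frechet_derivative (\<eta> c) (at w) v = Re (c * deriv h w * cnj b) * ?D (deriv h w * v) +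
      Re (c * (deriv (deriv h) w * v) * cnj b) * \<psi> (h w)" for c v
    using frechet_derivative_at[OF der] by metis
  let ?x = "Re (deriv h w * cnj b)" and ?y = "Re (\<i> * deriv h w * cnj b)"
  have "frechet_derivative (\<eta> 1) (at w) 1 + frechet_derivative (\<eta> \<i>) (at w) \<i>
     = ?x * ?D (deriv h w) + ?y * ?D (deriv h w * \<i>)"
    unfolding fr by (simp add: algebra_simps)
  also have "\<dots> = ?D (?x *\<^sub>R deriv h w + ?y *\<^sub>R (deriv h w * \<i>))"
    using lin by (simp add: linear_add linear_scale)
  also have "?x *\<^sub>R deriv h w + ?y *\<^sub>R (deriv h w * \<i>) = (cmod (deriv h w))\<^sup>2 *\<^sub>R b"
    unfolding cmod_power2 by (simp add: complex_eq_iff algebra_simps power2_eq_square)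
  also have "?D \<dots> = (cmod (deriv h w))\<^sup>2 * ?D b"
    using lin by (simp add: linear_scale)
  finally show ?thesis .
qed

text \<open>Integrals over \<open>A\<close> are moved to \<open>B\<close> by the substitution \<open>z = h w\<close>; there the derivative of the test
  function becomes a divergence, against which \<open>f\<close> can be integrated by parts, and the result is moved
  back.\<close>

lemma weak_gradient_compose:
  fixes f :: "complex \<Rightarrow> real"
  assumes A: "open A" "\<phi> holomorphic_on A" and hom: "homeomorphism A B \<phi> h"
    and f: "locally_summable_on B f" and g: "has_weak_gradient_on f g B"
  shows "has_weak_gradient_on (f \<circ> \<phi>) (\<lambda>z. cnj (deriv \<phi> z) * g (\<phi> z)) A"
proof -
  note bi = biholomorphic_derivs[OF A hom]
  have im: "\<phi> ` A = B" "h ` B = A" using hom by (auto simp: homeomorphism_def)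
  have Bm: "B \<in> sets lebesgue" using bi(1) by auto
  have gls: "locally_summable_on B (\<lambda>z. Re (g z))" "locally_summable_on B (\<lambda>z. Im (g z))"
    using has_weak_gradient_onD(1)[OF g] by (simp_all add: locally_summable_complex_iff)
  have cd: "continuous_on A (deriv \<phi>)"
    by (intro holomorphic_on_imp_continuous_on holomorphic_deriv A)
  have cRe: "continuous_on A (\<lambda>z. Re (deriv \<phi> z))" "continuous_on A (\<lambda>z. Im (deriv \<phi> z))"
    "continuous_on A (\<lambda>z. - Im (deriv \<phi> z))"
    by (intro continuous_intros cd)+
  let ?G = "\<lambda>z. cnj (deriv \<phi> z) * g (\<phi> z)"
  have lsG: "locally_summable_on A ?G"
  proof -
    have "locally_summable_on A (\<lambda>z. Re (deriv \<phi> z) * Re (g (\<phi> z)) + Im (deriv \<phi> z) * Im (g (\<phi> z)))"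
     "locally_summable_on A (\<lambda>z. Re (deriv \<phi> z) * Im (g (\<phi> z)) + (- Im (deriv \<phi> z)) * Re (g (\<phi> z)))"
      by (intro locally_summable_add locally_summable_continuous_mult cRe
          locally_summable_pullback[OF A hom] gls)+
    then show ?thesis by (simp add: locally_summable_complex_iff)
  qed
  have lsGb: "locally_summable_on A (\<lambda>z. ?G z \<bullet> b)" for b
  proof -
    have "locally_summable_on A (\<lambda>z. Re b * Re (?G z) + Im b * Im (?G z))"
      using lsG unfolding locally_summable_complex_iff
      by (intro locally_summable_add locally_summable_continuous_mult continuous_on_const) auto
    then show ?thesis by (simp only: inner_complex_def mult.commute)
  qed
  have lsf: "locally_summable_on A (f \<circ> \<phi>)"
    using locally_summable_pullback[OF A hom f] by (simp add: o_def)
  show ?thesis unfolding has_weak_gradient_on_def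
  proof (intro conjI lsG allI impI ballI)
    fix \<psi> b assume \<psi>: "test_function_on A \<psi>" and b: "b \<in> (Basis :: complex set)"
    define \<eta> where "\<eta> \<equiv> \<lambda>c w. if w \<in> B then Re (c * deriv h w * cnj b) * \<psi> (h w) else 0"
    have hol: "(\<lambda>w. c * deriv h w * cnj b) holomorphic_on B" for c
      by (intro holomorphic_intros holomorphic_deriv bi)
    have \<eta>: "test_function_on B (\<eta> c)" for c
      using test_function_pullback[OF A(1) bi(1,2) hol hom \<psi>] unfolding \<eta>_def by blast
    have cov: "set_integrable lebesgue A u \<Longrightarrow>
      (LINT w:B|lebesgue. (cmod (deriv h w))\<^sup>2 * u (h w)) = (LINT z:A|lebesgue. u z)" for u
      using holomorphic_change_of_variables(2)[OF Bm order_refl bi(1,2,6), unfolded im] .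
    let ?L = "\<lambda>c w. f w * frechet_derivative (\<eta> c) (at w) c"
    let ?R = "\<lambda>c w. (g w \<bullet> c) * \<eta> c w"
    have "(LINT z:A|lebesgue. (f \<circ> \<phi>) z * frechet_derivative \<psi> (at z) b) =
      (LINT w:B|lebesgue. (cmod (deriv h w))\<^sup>2 * ((f \<circ> \<phi>) (h w) * frechet_derivative \<psi> (at (h w)) b))"
      by (rule cov[symmetric]) (rule integrable_times_test(2)[OF lsf \<psi>])
    also have "\<dots> = (LINT w:B|lebesgue. ?L 1 w + ?L \<i> w)"
    proof (rule set_lebesgue_integral_cong[OF Bm], intro allI impI)
      fix w assume w: "w \<in> B"
      have "\<phi> (h w) = w" using w hom by (simp add: homeomorphism_def)
      then have "(cmod (deriv h w))\<^sup>2 * ((f \<circ> \<phi>) (h w) * frechet_derivative \<psi> (at (h w)) b)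
          = f w * ((cmod (deriv h w))\<^sup>2 * frechet_derivative \<psi> (at (h w)) b)" by simp
      also have "\<dots> = f w * (frechet_derivative (\<eta> 1) (at w) 1 + frechet_derivative (\<eta> \<i>) (at w) \<i>)"
        using pulled_back_test_divergence[OF A(1) bi(1,2) hom \<psi> w, of b] unfolding \<eta>_def by (simp only:)
      finally show "(cmod (deriv h w))\<^sup>2 * ((f \<circ> \<phi>) (h w) * frechet_derivative \<psi> (at (h w)) b) = ?L 1 w + ?L \<i> w"
        by (simp only: distrib_left)
    qed
    also have "\<dots> = (LINT w:B|lebesgue. ?L 1 w) + (LINT w:B|lebesgue. ?L \<i> w)"
      by (intro set_integral_add(2) integrable_times_test(2)[OF f \<eta>])
    also have "\<dots> = - ((LINT w:B|lebesgue. ?R 1 w) + (LINT w:B|lebesgue. ?R \<i> w))"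
      using has_weak_gradient_onD(2)[OF g \<eta>, of 1 1] has_weak_gradient_onD(2)[OF g \<eta>, of \<i> \<i>]
      by (simp add: Basis_complex_def)
    also have "(LINT w:B|lebesgue. ?R 1 w) + (LINT w:B|lebesgue. ?R \<i> w) = (LINT w:B|lebesgue. ?R 1 w + ?R \<i> w)"
      using integrable_times_test(1)[OF gls(1) \<eta>] integrable_times_test(1)[OF gls(2) \<eta>]
      by (intro set_integral_add(2)[symmetric]) simp_all
    also have "(LINT w:B|lebesgue. ?R 1 w + ?R \<i> w) =
      (LINT w:B|lebesgue. (cmod (deriv h w))\<^sup>2 * ((?G (h w) \<bullet> b) * \<psi> (h w)))"
    proof (rule set_lebesgue_integral_cong[OF Bm], intro allI impI)
      fix w assume w: "w \<in> B"
      have hw: "\<phi> (h w) = w" using w hom by (simp add: homeomorphism_def)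
      have "(cmod (deriv h w))\<^sup>2 *\<^sub>R ?G (h w) = deriv h w * cnj (deriv h w * deriv \<phi> (h w)) * g w"
        by (simp add: scaleR_conv_of_real complex_norm_square hw del: of_real_power)
      then have e: "(cmod (deriv h w))\<^sup>2 *\<^sub>R ?G (h w) = deriv h w * g w" using bi(4)[OF w] by simp
      have "(cmod (deriv h w))\<^sup>2 * ((?G (h w) \<bullet> b) * \<psi> (h w)) = (((cmod (deriv h w))\<^sup>2 *\<^sub>R ?G (h w)) \<bullet> b) * \<psi> (h w)"
        by simp
      also have "\<dots> = ?R 1 w + ?R \<i> w"
        unfolding e using w by (simp add: \<eta>_def inner_complex_def algebra_simps)
      finally show "?R 1 w + ?R \<i> w = (cmod (deriv h w))\<^sup>2 * ((?G (h w) \<bullet> b) * \<psi> (h w))" by simp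
    qed
    also have "\<dots> = (LINT z:A|lebesgue. (?G z \<bullet> b) * \<psi> z)"
      by (rule cov) (rule integrable_times_test(1)[OF lsGb \<psi>])
    finally show "(LINT z:A|lebesgue. (f \<circ> \<phi>) z * frechet_derivative \<psi> (at z) b)
        = - (LINT z:A|lebesgue. (?G z \<bullet> b) * \<psi> z)" .
  qed
qed

section \<open>Classical gradients are weak gradients\<close>

text \<open>Translation invariance makes the integral of every difference quotient zero; the quotients are
  dominated by the mean value theorem.\<close>

lemma integral_derivative_compact_support:
  fixes F :: "'a::euclidean_space \<Rightarrow> real"
  assumes F: "\<And>z. (F has_derivative F' z) (at z)"
    and cont: "continuous_on UNIV (\<lambda>z. F' z b)"
    and K: "compact K" and 0: "\<And>z. z \<notin> K \<Longrightarrow> F z = 0" "\<And>z. z \<notin> K \<Longrightarrow> F' z b = 0"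
  shows "(LINT z|lebesgue. F' z b) = 0"
proof -
  obtain M where "\<And>z. z \<in> K \<Longrightarrow> norm (F' z b) \<le> M"
    using compact_imp_bounded[OF compact_continuous_image[OF continuous_on_subset[OF cont subset_UNIV] K]]
    by (auto simp: bounded_iff)
  then have M: "\<bar>F' z b\<bar> \<le> max M 0" for z using 0(2)[of z] by (cases "z \<in> K") force+
  obtain R where R: "\<And>z. z \<in> K \<Longrightarrow> norm z \<le> R"
    using compact_imp_bounded[OF K] by (auto simp: bounded_iff)
  have contF: "continuous_on UNIV F"
    using F has_derivative_continuous continuous_at_imp_continuous_on by blast
  then have mF[measurable]: "F \<in> borel_measurable borel" by (rule borel_measurable_continuous_onI)
  have mF'[measurable]: "(\<lambda>z. F' z b) \<in> borel_measurable borel" by (rule borel_measurable_continuous_onI[OF cont])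
  define C where "C = cball (0::'a) (R + norm b)"
  have intF: "integrable lborel F"
  proof -
    have "integrable lborel (\<lambda>z. indicator K z *\<^sub>R F z)"
      by (rule borel_integrable_compact[OF K continuous_on_subset[OF contF subset_UNIV]])
    also have "(\<lambda>z. indicator K z *\<^sub>R F z) = F" using 0(1) by (intro ext) (auto simp: indicator_def)
    finally show ?thesis .
  qed
  have trans: "integrable lborel (\<lambda>z. F (v + z))" "(LINT z|lborel. F (v + z)) = (LINT z|lborel. F z)" for v
  proof -
    have "integrable (distr lborel borel ((+) v)) F" using intF by (simp add: lborel_distr_plus)
    then show "integrable lborel (\<lambda>z. F (v + z))" by (subst (asm) integrable_distr_eq) auto
    have "(LINT z|distr lborel borel ((+) v). F z) = (LINT z|lborel. F (v + z))"
      by (rule integral_distr) auto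
    then show "(LINT z|lborel. F (v + z)) = (LINT z|lborel. F z)" by (simp add: lborel_distr_plus)
  qed
  define t where "t n = inverse (real (Suc n))" for n
  have t: "0 < t n" "t n \<le> 1" for n by (auto simp: t_def field_simps)
  define q where "q n z = (F (t n *\<^sub>R b + z) - F z) / t n" for n z
  have der: "((\<lambda>s. F (s *\<^sub>R b + z)) has_field_derivative F' (s *\<^sub>R b + z) b) (at s)" for s z
  proof -
    have "((\<lambda>s. s *\<^sub>R b + z) has_derivative (\<lambda>h. h *\<^sub>R b)) (at s)" by (auto intro!: derivative_eq_intros)
    from diff_chain_at[OF this F]
    have "((\<lambda>s. F (s *\<^sub>R b + z)) has_derivative (\<lambda>h. F' (s *\<^sub>R b + z) (h *\<^sub>R b))) (at s)" by (simp add: o_def)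
    moreover have "F' (s *\<^sub>R b + z) (h *\<^sub>R b) = F' (s *\<^sub>R b + z) b * h" for h
      using has_derivative_linear[OF F] by (simp add: linear_scale)
    ultimately show ?thesis by (simp add: has_field_derivative_def mult_commute_abs)
  qed
  have qb: "\<bar>q n z\<bar> \<le> max M 0 * indicator C z" for n z
  proof (cases "z \<in> C")
    case True
    obtain s where "F (t n *\<^sub>R b + z) - F (0 *\<^sub>R b + z) = (t n - 0) * F' (s *\<^sub>R b + z) b"
      using MVT2[OF t(1)[of n], of "\<lambda>s. F (s *\<^sub>R b + z)" "\<lambda>s. F' (s *\<^sub>R b + z) b"] der by blast
    then have "q n z = F' (s *\<^sub>R b + z) b" using t(1)[of n] by (simp add: q_def)
    then show ?thesis using M True by simp
  next
    case False
    then have n: "norm z > R + norm b" by (simp add: C_def)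
    have "norm (t n *\<^sub>R b) \<le> norm b" using t[of n] by (simp add: mult_left_le_one_le)
    then have "norm (t n *\<^sub>R b + z) > R" using n norm_triangle_ineq4[of "t n *\<^sub>R b + z" "t n *\<^sub>R b"] by simp
    then have "t n *\<^sub>R b + z \<notin> K" using R by force
    moreover have "z \<notin> K" using R[of z] n norm_ge_zero[of b] by force
    ultimately show ?thesis using 0(1) by (simp add: q_def)
  qed
  have lim: "(\<lambda>n. q n z) \<longlonglongrightarrow> F' z b" for z
  proof -
    have "((\<lambda>s. (F (s *\<^sub>R b + z) - F z) / s) \<longlongrightarrow> F' z b) (at 0)"
      using der[of z 0] by (simp add: has_field_derivative_iff)
    moreover have "filterlim t (at 0) sequentially"
      unfolding filterlim_at using t(1) LIMSEQ_inverse_real_of_nat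
      by (auto simp: t_def[abs_def] intro!: always_eventually)
    ultimately show ?thesis unfolding q_def by (rule filterlim_compose)
  qed
  have "(\<lambda>n. LINT z|lborel. q n z) \<longlonglongrightarrow> (LINT z|lborel. F' z b)"
  proof (rule integral_dominated_convergence[where w="\<lambda>z. max M 0 * indicator C z"])
    show "integrable lborel (\<lambda>z. max M 0 * indicator C z :: real)"
    proof -
      have "emeasure lborel C < \<infinity>" unfolding C_def by (rule emeasure_bounded_finite) simp
      moreover have "C \<in> sets lborel" by (simp add: C_def)
      ultimately show ?thesis by (intro integrable_mult_right integrable_real_indicator)
    qed
    show "q n \<in> borel_measurable lborel" for n unfolding q_def by measurable
  qed (use lim qb in auto)
  moreover have "(LINT z|lborel. q n z) = 0" for n
    unfolding q_def using trans[of "t n *\<^sub>R b"] intF by simp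
  ultimately have "(LINT z|lborel. F' z b) = 0" by (simp add: LIMSEQ_const_iff)
  then show ?thesis by (simp add: integral_completion)
qed

lemma has_weak_gradient_classical:
  fixes f :: "complex \<Rightarrow> real" and G :: "complex \<Rightarrow> complex"
  assumes \<Omega>: "open \<Omega>" and f: "\<And>z. z \<in> \<Omega> \<Longrightarrow> (f has_derivative (\<lambda>v. G z \<bullet> v)) (at z)"
    and G: "continuous_on \<Omega> G"
  shows "locally_summable_on \<Omega> f" "has_weak_gradient_on f G \<Omega>"
proof -
  have cf: "continuous_on \<Omega> f"
    using f has_derivative_continuous continuous_at_imp_continuous_on by blast
  then show lf: "locally_summable_on \<Omega> f" by (rule locally_summable_continuous)
  have lG: "locally_summable_on \<Omega> G"
    unfolding locally_summable_complex_iff using G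
    by (intro conjI locally_summable_continuous continuous_intros)
  show "has_weak_gradient_on f G \<Omega>" unfolding has_weak_gradient_on_def
  proof (intro conjI lG allI impI ballI)
    fix \<psi> and b :: complex assume \<psi>: "test_function_on \<Omega> \<psi>"
    note t = test_functionD[OF \<psi>]
    define S where "S = closure {z. \<psi> z \<noteq> 0}"
    define F where "F z = (if z \<in> \<Omega> then f z * \<psi> z else 0)" for z
    define F' where "F' z v = (if z \<in> \<Omega> then f z * frechet_derivative \<psi> (at z) v + (G z \<bullet> v) * \<psi> z else 0)" for z v
    have S: "compact S" "S \<subseteq> \<Omega>" "open (- S)" "\<Omega> \<union> - S = UNIV"
      using t(4,5) compact_imp_closed unfolding S_def by auto
    have S0: "F z = 0" "F' z v = 0" if "z \<notin> S" for z v
      using t(6,7)[OF that[unfolded S_def]] by (simp_all add: F_def F'_def)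
    have der: "(F has_derivative F' z) (at z)" for z
    proof (cases "z \<in> \<Omega>")
      case True
      have "(F has_derivative (\<lambda>v. f z * frechet_derivative \<psi> (at z) v + (G z \<bullet> v) * \<psi> z)) (at z)"
        by (rule has_derivative_transform_within_open[OF has_derivative_mult[OF f[OF True] t(2)] \<Omega> True])
          (simp add: F_def)
      then show ?thesis using True by (simp add: F'_def[abs_def])
    next
      case False
      then have z: "z \<in> - S" using S by auto
      have "(F has_derivative (\<lambda>v. 0)) (at z)"
        by (rule has_derivative_transform_within_open[OF has_derivative_const S(3) z]) (simp add: S0)
      moreover have "F' z = (\<lambda>v. 0)" by (rule ext) (use S0(2) z in auto)
      ultimately show ?thesis by simp
    qed
    have "continuous_on \<Omega> (\<lambda>z. F' z b)"
    proof -
      have "continuous_on \<Omega> (\<lambda>z. f z * frechet_derivative \<psi> (at z) b + (G z \<bullet> b) * \<psi> z)"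
        using t(1,3) continuous_on_subset by (intro continuous_intros cf G) blast+
      then show ?thesis by (simp add: F'_def cong: continuous_on_cong)
    qed
    moreover have "continuous_on (- S) (\<lambda>z. F' z b)"
      using continuous_on_cong[of "- S" "- S" "\<lambda>z. F' z b" "\<lambda>z. 0"] S0(2) by simp
    ultimately have cont: "continuous_on UNIV (\<lambda>z. F' z b)"
      using continuous_on_open_Un[OF \<Omega> S(3)] S(4) by metis
    have "(LINT z|lebesgue. F' z b) = 0"
      by (rule integral_derivative_compact_support[OF der cont S(1) S0])
    moreover have "(LINT z|lebesgue. F' z b) =
        (LINT z:\<Omega>|lebesgue. f z * frechet_derivative \<psi> (at z) b + (G z \<bullet> b) * \<psi> z)"
      unfolding set_lebesgue_integral_def by (rule Bochner_Integration.integral_cong) (auto simp: F'_def)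
    moreover have "locally_summable_on \<Omega> (\<lambda>z. G z \<bullet> b)"
      by (intro locally_summable_continuous continuous_intros G)
    ultimately show "(LINT z:\<Omega>|lebesgue. f z * frechet_derivative \<psi> (at z) b) =
        - (LINT z:\<Omega>|lebesgue. (G z \<bullet> b) * \<psi> z)"
      using set_integral_add(2)[OF integrable_times_test(2)[OF lf \<psi>, of b] integrable_times_test(1)[of \<Omega> "\<lambda>z. G z \<bullet> b", OF _ \<psi>]]
      by linarith
  qed
qed

section \<open>Integrability implies boundedness\<close>

text \<open>Weighted arithmetic-geometric mean inequality for \<open>u / \<integral>u\<close> and \<open>v / \<integral>v\<close>; if one of the integrals vanishes,
  so does the product almost everywhere.\<close>

lemma Holder_powr:
  fixes u v :: "'a \<Rightarrow> real"
  assumes u: "integrable M u" "\<And>x. 0 \<le> u x" and v: "integrable M v" "\<And>x. 0 \<le> v x" and \<theta>: "0 < \<theta>" "\<theta> < 1"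
  shows "integrable M (\<lambda>x. u x powr \<theta> * v x powr (1 - \<theta>))"
    and "(LINT x|M. u x powr \<theta> * v x powr (1 - \<theta>)) \<le> (LINT x|M. u x) powr \<theta> * (LINT x|M. v x) powr (1 - \<theta>)"
proof -
  let ?w = "\<lambda>x. u x powr \<theta> * v x powr (1 - \<theta>)"
  have [measurable]: "u \<in> borel_measurable M" "v \<in> borel_measurable M" using u v by auto
  have Y: "a powr \<theta> * b powr (1 - \<theta>) \<le> \<theta> * a + (1 - \<theta>) * b" if "0 \<le> a" "0 \<le> b" for a b :: real
    using Youngs_inequality_0[of \<theta> "1 - \<theta>" a b] \<theta> that by (cases "a = 0 \<or> b = 0") auto
  show int: "integrable M ?w"
  proof (rule Bochner_Integration.integrable_bound)
    show "integrable M (\<lambda>x. \<theta> * u x + (1 - \<theta>) * v x)" using u v by simp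
    show "AE x in M. norm (?w x) \<le> norm (\<theta> * u x + (1 - \<theta>) * v x)"
    proof (rule AE_I2)
      fix x
      have "norm (?w x) = ?w x" by simp
      also have "\<dots> \<le> \<theta> * u x + (1 - \<theta>) * v x" by (rule Y[OF u(2) v(2)])
      finally show "norm (?w x) \<le> norm (\<theta> * u x + (1 - \<theta>) * v x)" by simp
    qed
  qed measurable
  define U V where "U = (LINT x|M. u x)" and "V = (LINT x|M. v x)"
  have nn: "U \<ge> 0" "V \<ge> 0" unfolding U_def V_def using u(2) v(2) by (simp_all add: Bochner_Integration.integral_nonneg)
  consider "U = 0" | "V = 0" | "U > 0" "V > 0" using nn by linarith
  then have "(LINT x|M. ?w x) \<le> U powr \<theta> * V powr (1 - \<theta>)"
  proof cases
    case 1
    then have "AE x in M. u x = 0"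
      using integral_nonneg_eq_0_iff_AE[OF u(1)] u(2) by (simp add: U_def)
    then have "AE x in M. ?w x = 0" by eventually_elim simp
    then have "(LINT x|M. ?w x) = 0" by (intro integral_eq_zero_AE)
    then show ?thesis by simp
  next
    case 2
    then have "AE x in M. v x = 0"
      using integral_nonneg_eq_0_iff_AE[OF v(1)] v(2) by (simp add: V_def)
    then have "AE x in M. ?w x = 0" by eventually_elim simp
    then have "(LINT x|M. ?w x) = 0" by (intro integral_eq_zero_AE)
    then show ?thesis by simp
  next
    case 3
    let ?c = "U powr \<theta> * V powr (1 - \<theta>)"
    have c: "?c > 0" using 3 by simp
    have le: "?w x \<le> ?c * (\<theta> * (u x / U) + (1 - \<theta>) * (v x / V))" for x
    proof -
      have "?w x = ?c * ((u x / U) powr \<theta> * (v x / V) powr (1 - \<theta>))"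
        using 3 u(2) v(2) by (simp add: powr_divide)
      also have "\<dots> \<le> ?c * (\<theta> * (u x / U) + (1 - \<theta>) * (v x / V))"
        using c 3 u(2) v(2) by (intro mult_left_mono Y) simp_all
      finally show ?thesis .
    qed
    have "(LINT x|M. ?w x) \<le> (LINT x|M. ?c * (\<theta> * (u x / U) + (1 - \<theta>) * (v x / V)))"
      by (rule integral_mono[OF int _ le]) (use u v in simp)
    also have "\<dots> = ?c * (\<theta> * (U / U) + (1 - \<theta>) * (V / V))"
      using u v by (simp add: U_def V_def)
    also have "\<dots> = ?c" using 3 by simp
    finally show ?thesis .
  qed
  then show "(LINT x|M. ?w x) \<le> (LINT x|M. u x) powr \<theta> * (LINT x|M. v x) powr (1 - \<theta>)"
    by (simp add: U_def V_def)
qed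

lemma sobolev_weak_gradient:
  fixes f :: "complex \<Rightarrow> real"
  assumes "open \<Omega>" "has_weak_gradient_on f g \<Omega>"
  shows "f \<in> sobolev_L1 p \<Omega> \<longleftrightarrow>
      locally_summable_on \<Omega> f \<and> set_integrable lebesgue \<Omega> (\<lambda>z. norm (g z) powr p)"
    and "sobolev_seminorm p \<Omega> f = (LINT z:\<Omega>|lebesgue. norm (g z) powr p) powr (1 / p)"
proof -
  have "weakly_differentiable_on f \<Omega>" unfolding weakly_differentiable_on_def using assms(2) by (rule exI[of _ g])
  then show "f \<in> sobolev_L1 p \<Omega> \<longleftrightarrow>
      locally_summable_on \<Omega> f \<and> set_integrable lebesgue \<Omega> (\<lambda>z. norm (g z) powr p)"
    unfolding sobolev_L1_def mem_Collect_eq weak_gradient_integral(1)[OF assms] by simp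
  show "sobolev_seminorm p \<Omega> f = (LINT z:\<Omega>|lebesgue. norm (g z) powr p) powr (1 / p)"
    unfolding sobolev_seminorm_def weak_gradient_integral(2)[OF assms] by (rule refl)
qed

text \<open>Hoelder's inequality with the weights \<open>\<theta> = q / p\<close> and \<open>1 - \<theta>\<close>. The relation between \<open>p\<close>, \<open>q\<close> and \<open>s\<close> is
  what makes the powers of \<open>|\<phi>'|\<close> add up to \<open>q\<close>.\<close>

lemma composition_operator_bounded:
  assumes A: "open A" "\<phi> holomorphic_on A" and hom: "homeomorphism A B \<phi> h"
    and pq: "0 < q" "q < p" and s: "s * (p - q) = q * (p - 2)"
    and int: "set_integrable lebesgue A (\<lambda>z. cmod (deriv \<phi> z) powr s)"
  shows "generates_bounded_composition_operator p q A B \<phi>"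
proof -
  note bi = biholomorphic_derivs[OF A hom]
  have im: "\<phi> ` A = B" using hom by (auto simp: homeomorphism_def)
  have Am: "A \<in> sets lebesgue" using A by auto
  define V where "V = (LINT z:A|lebesgue. cmod (deriv \<phi> z) powr s)"
  define \<theta> where "\<theta> = q / p"
  have \<theta>: "0 < \<theta>" "\<theta> < 1" using pq by (auto simp: \<theta>_def)
  have exponent: "2 * \<theta> + s * (1 - \<theta>) = q"
  proof -
    have "2 * \<theta> + s * (1 - \<theta>) = (2 * q + s * (p - q)) / p" using pq by (simp add: \<theta>_def field_simps)
    also have "\<dots> = q" using pq by (simp add: s field_simps)
    finally show ?thesis .
  qed
  have main: "f \<circ> \<phi> \<in> sobolev_L1 q A \<and>
      sobolev_seminorm q A (f \<circ> \<phi>) \<le> V powr ((1 - \<theta>) / q) * sobolev_seminorm p B f"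
    if f: "f \<in> sobolev_L1 p B" for f
  proof -
    obtain g where g: "has_weak_gradient_on f g B"
      using f by (auto simp: sobolev_L1_def weakly_differentiable_on_def)
    note sB = sobolev_weak_gradient[OF bi(1) g, of p]
    have lf: "locally_summable_on B f" and ig: "set_integrable lebesgue B (\<lambda>w. norm (g w) powr p)"
      using f sB(1) by auto
    let ?G = "\<lambda>z. cnj (deriv \<phi> z) * g (\<phi> z)"
    have G: "has_weak_gradient_on (f \<circ> \<phi>) ?G A" by (rule weak_gradient_compose[OF A hom lf g])
    define u where "u z = indicator A z * ((cmod (deriv \<phi> z))\<^sup>2 * norm (g (\<phi> z)) powr p)" for z
    define v where "v z = indicator A z * cmod (deriv \<phi> z) powr s" for z
    define U where "U = (LINT w:B|lebesgue. norm (g w) powr p)"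
    have u: "integrable lebesgue u" "(LINT z|lebesgue. u z) = U"
      using holomorphic_change_of_variables[OF Am order_refl A bi(5), unfolded im, of "\<lambda>w. norm (g w) powr p"] ig
      by (simp_all add: u_def[abs_def] set_integrable_def set_lebesgue_integral_def U_def)
    have v: "integrable lebesgue v" "(LINT z|lebesgue. v z) = V"
      using int by (simp_all add: v_def[abs_def] set_integrable_def set_lebesgue_integral_def V_def)
    have uv: "u z powr \<theta> * v z powr (1 - \<theta>) = indicator A z *\<^sub>R norm (?G z) powr q" for z
    proof (cases "z \<in> A")
      case True
      define d where "d = cmod (deriv \<phi> z)"
      define m where "m = cmod (g (\<phi> z))"
      have d: "d > 0" and m: "m \<ge> 0" using bi(3)[OF True] by (auto simp: d_def m_def)
      have "(d\<^sup>2 * m powr p) powr \<theta> * (d powr s) powr (1 - \<theta>) =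
          d powr (2 * \<theta>) * m powr (p * \<theta>) * d powr (s * (1 - \<theta>))"
      proof -
        have "d\<^sup>2 = d powr 2" using d by simp
        then show ?thesis using d m by (simp only: powr_mult powr_powr powr_ge_zero)
      qed
      also have "\<dots> = d powr (2 * \<theta> + s * (1 - \<theta>)) * m powr (p * \<theta>)"
        by (simp add: powr_add)
      also have "\<dots> = (d * m) powr q"
      proof -
        have "p * \<theta> = q" using pq by (simp add: \<theta>_def)
        then show ?thesis by (simp only: exponent powr_mult)
      qed
      finally show ?thesis using True by (simp add: u_def v_def d_def m_def norm_mult)
    qed (simp add: u_def v_def)
    have pos: "0 \<le> u z" "0 \<le> v z" for z by (simp_all add: u_def v_def)
    note H = Holder_powr[OF u(1) pos(1) v(1) pos(2) \<theta>]
    have iG: "set_integrable lebesgue A (\<lambda>z. norm (?G z) powr q)"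
      using H(1) unfolding uv by (simp add: set_integrable_def)
    have leG: "(LINT z:A|lebesgue. norm (?G z) powr q) \<le> U powr \<theta> * V powr (1 - \<theta>)"
      using H(2) unfolding uv u(2) v(2) by (simp add: set_lebesgue_integral_def)
    have nn: "0 \<le> (LINT z:A|lebesgue. norm (?G z) powr q)" "0 \<le> U" "0 \<le> V"
      unfolding U_def V_def set_lebesgue_integral_def by (auto intro!: Bochner_Integration.integral_nonneg)
    have "sobolev_seminorm q A (f \<circ> \<phi>) \<le> (U powr \<theta> * V powr (1 - \<theta>)) powr (1 / q)"
      unfolding sobolev_weak_gradient(2)[OF A(1) G] using pq nn by (intro powr_mono2 leG) auto
    also have "\<dots> = V powr ((1 - \<theta>) / q) * U powr (1 / p)"
      using nn pq by (simp add: powr_mult powr_powr \<theta>_def)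
    finally show ?thesis
      using sobolev_weak_gradient(1)[OF A(1) G, of q] iG locally_summable_pullback[OF A hom lf] sB(2)
      by (simp add: U_def o_def)
  qed
  then show ?thesis unfolding generates_bounded_composition_operator_def by blast
qed

section \<open>Boundedness implies integrability\<close>

lemma Ck_on_gradient:
  fixes a :: "complex \<Rightarrow> real"
  assumes "open D" "Ck_on D (Suc 0) a"
  obtains G where "continuous_on D G" "\<And>z. z \<in> D \<Longrightarrow> (a has_derivative (\<lambda>v. G z \<bullet> v)) (at z)"
proof
  let ?G = "\<lambda>z. Complex (frechet_derivative a (at z) 1) (frechet_derivative a (at z) \<i>)"
  have c: "continuous_on D (\<lambda>z. frechet_derivative a (at z) v)" for v using assms(2) by simp
  have "continuous_on D (\<lambda>z. of_real (frechet_derivative a (at z) 1) + \<i> * of_real (frechet_derivative a (at z) \<i>))"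
    by (intro continuous_intros c)
  then show "continuous_on D ?G" by (simp add: complex_eq[symmetric] Complex_eq)
  fix z assume z: "z \<in> D"
  have d: "(a has_derivative frechet_derivative a (at z)) (at z)" by (rule Ck_on_SucD[OF assms(2) z])
  have "frechet_derivative a (at z) = (\<lambda>v. ?G z \<bullet> v)"
  proof (rule ext)
    fix v show "frechet_derivative a (at z) v = ?G z \<bullet> v"
      using complex_linear_expand[OF has_derivative_linear[OF d], of v] by (simp add: inner_complex_def)
  qed
  then show "(a has_derivative (\<lambda>v. ?G z \<bullet> v)) (at z)" using d by simp
qed

lemma gradient_outside_support:
  fixes a :: "complex \<Rightarrow> real"
  assumes D: "open D" and a: "\<And>z. z \<in> D \<Longrightarrow> (a has_derivative (\<lambda>v. G z \<bullet> v)) (at z)"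
    and C: "compact C" "\<And>z. z \<in> D - C \<Longrightarrow> a z = 0" and z: "z \<in> D - C"
  shows "G z = 0"
proof -
  have o: "open (D - C)" using D C(1) compact_imp_closed by blast
  have "((\<lambda>z. 0) has_derivative (\<lambda>v. G z \<bullet> v)) (at z)"
    by (rule has_derivative_transform_within_open[OF a o z]) (use z C(2) in auto)
  from has_derivative_unique[OF this has_derivative_const]
  have "(\<lambda>v. G z \<bullet> v) = (\<lambda>v. 0)" .
  then have "G z \<bullet> G z = 0" by metis
  then show ?thesis by simp
qed

text \<open>Boundedness of the operator is inherited by the inequality between the underlying weights, for
  an arbitrary amplitude \<open>a\<close> in place of a gradient: the functions \<open>a cos (n x) / n\<close> and \<open>a sin (n x) / n\<close> have
  gradients whose squared moduli add up to \<open>a\<^sup>2 + |\<nabla>a|\<^sup>2 / n\<^sup>2\<close>, so at each point one of them is at least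
  of size \<open>|a| / 2\<close>, while both are at most \<open>|a| + o(1)\<close>.\<close>

lemma composition_bound_amplitude:
  assumes A: "open A" "\<phi> holomorphic_on A" and hom: "homeomorphism A B \<phi> h"
    and pq: "0 < q" "q < p" and gen: "generates_bounded_composition_operator p q A B \<phi>"
  shows "\<exists>c\<ge>0. \<forall>a C. Ck_on B (Suc 0) a \<and> compact C \<and> C \<subseteq> B \<and> (\<forall>w\<in>B - C. a w = 0) \<longrightarrow>
       set_integrable lebesgue A (\<lambda>z. (cmod (deriv \<phi> z) * \<bar>a (\<phi> z)\<bar>) powr q) \<and>
       set_integrable lebesgue B (\<lambda>w. \<bar>a w\<bar> powr p) \<and>
       (LINT z:A|lebesgue. (cmod (deriv \<phi> z) * \<bar>a (\<phi> z)\<bar>) powr q)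
         \<le> c * (LINT w:B|lebesgue. \<bar>a w\<bar> powr p) powr (q / p)"
proof -
  note bi = biholomorphic_derivs[OF A hom]
  have im: "\<phi> ` A = B" "h ` B = A" using hom by (auto simp: homeomorphism_def)
  have Am: "A \<in> sets lebesgue" "B \<in> sets lebesgue" using A bi(1) by auto
  obtain K0 where K0: "\<And>f. f \<in> sobolev_L1 p B \<Longrightarrow> sobolev_seminorm q A (f \<circ> \<phi>) \<le> K0 * sobolev_seminorm p B f"
    and in_sob: "\<And>f. f \<in> sobolev_L1 p B \<Longrightarrow> f \<circ> \<phi> \<in> sobolev_L1 q A"
    using gen unfolding generates_bounded_composition_operator_def by blast
  define K where "K = max K0 0"
  have K: "K \<ge> 0" by (simp add: K_def)
  have grad: "set_integrable lebesgue A (\<lambda>z. (cmod (deriv \<phi> z) * norm (G (\<phi> z))) powr q) \<and>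
      (LINT z:A|lebesgue. (cmod (deriv \<phi> z) * norm (G (\<phi> z))) powr q)
        \<le> K powr q * (LINT w:B|lebesgue. norm (G w) powr p) powr (q / p)"
    if f: "\<And>w. w \<in> B \<Longrightarrow> (f has_derivative (\<lambda>v. G w \<bullet> v)) (at w)" and G: "continuous_on B G"
      and ig: "set_integrable lebesgue B (\<lambda>w. norm (G w) powr p)" for f G
  proof -
    note cl = has_weak_gradient_classical[OF bi(1) f G]
    have fS: "f \<in> sobolev_L1 p B" using sobolev_weak_gradient(1)[OF bi(1) cl(2)] cl(1) ig by blast
    note W = weak_gradient_compose[OF A hom cl]
    let ?I = "LINT z:A|lebesgue. (cmod (deriv \<phi> z) * norm (G (\<phi> z))) powr q"
    let ?J = "LINT w:B|lebesgue. norm (G w) powr p"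
    have nn: "0 \<le> ?I" "0 \<le> ?J"
      unfolding set_lebesgue_integral_def by (auto intro!: Bochner_Integration.integral_nonneg)
    have "set_integrable lebesgue A (\<lambda>z. (cmod (deriv \<phi> z) * norm (G (\<phi> z))) powr q)"
      using in_sob[OF fS] sobolev_weak_gradient(1)[OF A(1) W, of q] by (simp add: norm_mult)
    moreover have "?I powr (1 / q) \<le> K0 * ?J powr (1 / p)"
      using K0[OF fS] sobolev_weak_gradient(2)[OF A(1) W, of q] sobolev_weak_gradient(2)[OF bi(1) cl(2), of p]
      by (simp add: norm_mult)
    then have "?I powr (1 / q) \<le> K * ?J powr (1 / p)"
      by (rule order_trans) (simp add: K_def mult_right_mono)
    then have "(?I powr (1 / q)) powr q \<le> (K * ?J powr (1 / p)) powr q"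
      using pq by (intro powr_mono2) auto
    then have "?I \<le> K powr q * ?J powr (q / p)"
      using nn pq K by (simp add: powr_powr powr_mult)
    ultimately show ?thesis by blast
  qed
  define c where "c = 2 powr q * 2 * K powr q"
  have "set_integrable lebesgue A (\<lambda>z. (cmod (deriv \<phi> z) * \<bar>a (\<phi> z)\<bar>) powr q) \<and>
       set_integrable lebesgue B (\<lambda>w. \<bar>a w\<bar> powr p) \<and>
       (LINT z:A|lebesgue. (cmod (deriv \<phi> z) * \<bar>a (\<phi> z)\<bar>) powr q)
         \<le> c * (LINT w:B|lebesgue. \<bar>a w\<bar> powr p) powr (q / p)"
    if a: "Ck_on B (Suc 0) a" and C: "compact C" "C \<subseteq> B" "\<And>w. w \<in> B - C \<Longrightarrow> a w = 0" for a C
  proof -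
    obtain Ga where Ga: "continuous_on B Ga" "\<And>z. z \<in> B \<Longrightarrow> (a has_derivative (\<lambda>v. Ga z \<bullet> v)) (at z)"
      using Ck_on_gradient[OF bi(1) a] by blast
    have Ga0: "Ga w = 0" if "w \<in> B - C" for w
      by (rule gradient_outside_support[OF bi(1) Ga(2) C(1,3) that])
    have ca: "continuous_on B a" by (rule Ck_on_continuous[OF a])
    have ints: "set_integrable lebesgue B (\<lambda>w. u w powr p)"
      if "continuous_on B u" "\<And>w. 0 \<le> u w" "\<And>w. w \<in> B - C \<Longrightarrow> u w = 0" for u :: "complex \<Rightarrow> real"
    proof (rule locally_summable_compact_support[OF _ C(1,2)])
      show "locally_summable_on B (\<lambda>w. u w powr p)"
        by (intro locally_summable_continuous continuous_on_powr' that(1) continuous_on_const) (use that pq in auto)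
    qed (use that in auto)
    define N where "N n w = sqrt ((a w)\<^sup>2 + (cmod (Ga w) / real (Suc n))\<^sup>2)" for n w
    have cN: "continuous_on B (N n)" for n
      unfolding N_def by (intro continuous_intros ca Ga) auto
    have N0: "N n w = 0" if "w \<in> B - C" for n w using C(3)[OF that] Ga0[OF that] by (simp add: N_def)
    have Npos: "0 \<le> N n w" for n w by (simp add: N_def)
    have iN: "set_integrable lebesgue B (\<lambda>w. N n w powr p)" for n
      by (rule ints[OF cN Npos N0])
    have ia: "set_integrable lebesgue B (\<lambda>w. \<bar>a w\<bar> powr p)"
      by (rule ints[OF continuous_on_rabs[OF ca] abs_ge_zero]) (simp add: C(3))
    have iA: "set_integrable lebesgue A (\<lambda>z. (cmod (deriv \<phi> z) * \<bar>a (\<phi> z)\<bar>) powr q)"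
    proof (rule locally_summable_compact_support)
      have "continuous_on A (\<lambda>z. a (\<phi> z))"
        using continuous_on_compose2[OF ca holomorphic_on_imp_continuous_on[OF A(2)]] im by blast
      moreover have "continuous_on A (deriv \<phi>)"
        by (intro holomorphic_on_imp_continuous_on holomorphic_deriv A)
      ultimately have "continuous_on A (\<lambda>z. (cmod (deriv \<phi> z) * \<bar>a (\<phi> z)\<bar>) powr q)"
        using pq by (intro continuous_on_powr' continuous_intros) auto
      then show "locally_summable_on A (\<lambda>z. (cmod (deriv \<phi> z) * \<bar>a (\<phi> z)\<bar>) powr q)"
        by (rule locally_summable_continuous)
      show "compact (h ` C)"
        using C continuous_on_subset[OF holomorphic_on_imp_continuous_on[OF bi(2)]] compact_continuous_image by blast
      show "h ` C \<subseteq> A" using C(2) im by blast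
      fix z assume z: "z \<in> A" "z \<notin> h ` C"
      have "\<phi> z \<in> B - C"
        using z im hom by (auto simp: homeomorphism_def) (metis image_eqI)
      then show "(cmod (deriv \<phi> z) * \<bar>a (\<phi> z)\<bar>) powr q = 0" using C(3) by simp
    qed
    define I where "I = (LINT z:A|lebesgue. (cmod (deriv \<phi> z) * \<bar>a (\<phi> z)\<bar>) powr q)"
    have step: "I \<le> c * (LINT w:B|lebesgue. N n w powr p) powr (q / p)" for n
    proof -
      define r where "r = real (Suc n)"
      have r: "r > 0" by (simp add: r_def)
      define f1 where "f1 w = a w * (cos (r * Re w) / r)" for w
      define f2 where "f2 w = a w * (sin (r * Re w) / r)" for w
      define G1 where "G1 w = (cos (r * Re w) / r) *\<^sub>R Ga w - (a w * sin (r * Re w)) *\<^sub>R 1" for w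
      define G2 where "G2 w = (sin (r * Re w) / r) *\<^sub>R Ga w + (a w * cos (r * Re w)) *\<^sub>R 1" for w
      have trig: "((\<lambda>w. cos (r * Re w) / r) has_derivative (\<lambda>v. - (sin (r * Re w) * Re v))) (at w)"
        "((\<lambda>w. sin (r * Re w) / r) has_derivative (\<lambda>v. cos (r * Re w) * Re v)) (at w)" for w
        using r by (auto intro!: derivative_eq_intros)
      have d1: "(f1 has_derivative (\<lambda>v. G1 w \<bullet> v)) (at w)" if "w \<in> B" for w
      proof -
        have "(\<lambda>v. G1 w \<bullet> v) = (\<lambda>v. a w * (- (sin (r * Re w) * Re v)) + (Ga w \<bullet> v) * (cos (r * Re w) / r))"
          by (rule ext) (simp add: G1_def inner_diff_left)
        then show ?thesis unfolding f1_def using has_derivative_mult[OF Ga(2)[OF that] trig(1)] by simp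
      qed
      have d2: "(f2 has_derivative (\<lambda>v. G2 w \<bullet> v)) (at w)" if "w \<in> B" for w
      proof -
        have "(\<lambda>v. G2 w \<bullet> v) = (\<lambda>v. a w * (cos (r * Re w) * Re v) + (Ga w \<bullet> v) * (sin (r * Re w) / r))"
          by (rule ext) (simp add: G2_def inner_add_left)
        then show ?thesis unfolding f2_def using has_derivative_mult[OF Ga(2)[OF that] trig(2)] by simp
      qed
      have c1: "continuous_on B G1" and c2: "continuous_on B G2"
        unfolding G1_def G2_def using r by (auto intro!: continuous_intros ca Ga(1))
      have sq: "(cmod (G1 w))\<^sup>2 + (cmod (G2 w))\<^sup>2 = (N n w)\<^sup>2" for w
      proof -
        define x y k l where "x = Re (Ga w) / r" and "y = Im (Ga w) / r"
          and "k = cos (r * Re w)" and "l = sin (r * Re w)"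
        have kl: "k\<^sup>2 + l\<^sup>2 = 1" by (simp add: k_def l_def)
        have "(cmod (G1 w))\<^sup>2 + (cmod (G2 w))\<^sup>2
          = (k * x - a w * l)\<^sup>2 + (k * y)\<^sup>2 + ((l * x + a w * k)\<^sup>2 + (l * y)\<^sup>2)"
          unfolding cmod_power2 by (simp add: G1_def G2_def x_def y_def k_def l_def)
        also have "\<dots> = (k\<^sup>2 + l\<^sup>2) * (x\<^sup>2 + y\<^sup>2 + (a w)\<^sup>2)" by algebra
        also have "\<dots> = (a w)\<^sup>2 + (cmod (Ga w) / r)\<^sup>2"
          unfolding kl power_divide[of "cmod (Ga w)"] cmod_power2
          by (simp add: x_def y_def power_divide add_divide_distrib)
        finally show ?thesis by (simp add: N_def r_def)
      qed
      have le1: "cmod (G1 w) \<le> N n w" and le2: "cmod (G2 w) \<le> N n w" for w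
      proof -
        have "(cmod (G1 w))\<^sup>2 \<le> (N n w)\<^sup>2" "(cmod (G2 w))\<^sup>2 \<le> (N n w)\<^sup>2"
          using sq[of w] zero_le_power2[of "cmod (G1 w)"] zero_le_power2[of "cmod (G2 w)"] by linarith+
        then show "cmod (G1 w) \<le> N n w" "cmod (G2 w) \<le> N n w"
          using power2_le_imp_le[OF _ Npos] by blast+
      qed
      have z1: "cmod (G1 w) = 0" and z2: "cmod (G2 w) = 0" if "w \<in> B - C" for w
        using le1[of w] le2[of w] N0[OF that] by simp_all
      have i1: "set_integrable lebesgue B (\<lambda>w. cmod (G1 w) powr p)"
        by (rule ints[OF continuous_on_norm[OF c1] norm_ge_zero z1])
      have i2: "set_integrable lebesgue B (\<lambda>w. cmod (G2 w) powr p)"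
        by (rule ints[OF continuous_on_norm[OF c2] norm_ge_zero z2])
      define J where "J = (LINT w:B|lebesgue. N n w powr p)"
      have J1: "(LINT w:B|lebesgue. cmod (G1 w) powr p) \<le> J"
        unfolding J_def by (rule set_integral_mono[OF i1 iN], rule powr_mono2) (use le1 pq in auto)
      have J2: "(LINT w:B|lebesgue. cmod (G2 w) powr p) \<le> J"
        unfolding J_def by (rule set_integral_mono[OF i2 iN], rule powr_mono2) (use le2 pq in auto)
      note g1 = grad[OF d1 c1 i1] and g2 = grad[OF d2 c2 i2]
      let ?I1 = "LINT z:A|lebesgue. (cmod (deriv \<phi> z) * cmod (G1 (\<phi> z))) powr q"
      let ?I2 = "LINT z:A|lebesgue. (cmod (deriv \<phi> z) * cmod (G2 (\<phi> z))) powr q"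
      have nn: "0 \<le> (LINT w:B|lebesgue. cmod (G1 w) powr p)" "0 \<le> (LINT w:B|lebesgue. cmod (G2 w) powr p)"
        unfolding set_lebesgue_integral_def by (auto intro!: Bochner_Integration.integral_nonneg)
      have I1: "?I1 \<le> K powr q * J powr (q / p)"
        using g1 pq by (intro order_trans[OF conjunct2[OF g1]] mult_left_mono powr_mono2 nn J1) auto
      have I2: "?I2 \<le> K powr q * J powr (q / p)"
        using g2 pq by (intro order_trans[OF conjunct2[OF g2]] mult_left_mono powr_mono2 nn J2) auto
      have pw: "(d * \<bar>a w\<bar>) powr q \<le> 2 powr q * ((d * cmod (G1 w)) powr q + (d * cmod (G2 w)) powr q)"
        if "d \<ge> 0" for d w
      proof -
        let ?m = "max (cmod (G1 w)) (cmod (G2 w))"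
        have "(a w)\<^sup>2 \<le> (cmod (G1 w))\<^sup>2 + (cmod (G2 w))\<^sup>2" by (simp add: sq N_def)
        also have "\<dots> \<le> (cmod (G1 w) + cmod (G2 w))\<^sup>2" by (simp add: power2_sum)
        finally have "\<bar>a w\<bar>\<^sup>2 \<le> (cmod (G1 w) + cmod (G2 w))\<^sup>2" by simp
        then have "\<bar>a w\<bar> \<le> cmod (G1 w) + cmod (G2 w)"
          by (rule power2_le_imp_le) simp
        also have "\<dots> \<le> 2 * ?m" by simp
        finally have "d * \<bar>a w\<bar> \<le> 2 * (d * ?m)"
          using that mult_left_mono[of "\<bar>a w\<bar>" "2 * ?m" d] by (simp add: mult_ac)
        then have "(d * \<bar>a w\<bar>) powr q \<le> (2 * (d * ?m)) powr q"
          using that pq by (intro powr_mono2) auto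
        also have "\<dots> = 2 powr q * (d * ?m) powr q" by (rule powr_mult)
        also have "(d * ?m) powr q \<le> (d * cmod (G1 w)) powr q + (d * cmod (G2 w)) powr q"
          by (auto simp: max_def)
        finally show ?thesis by simp
      qed
      have "I \<le> (LINT z:A|lebesgue. 2 powr q * ((cmod (deriv \<phi> z) * cmod (G1 (\<phi> z))) powr q
           + (cmod (deriv \<phi> z) * cmod (G2 (\<phi> z))) powr q))"
        unfolding I_def
      proof (rule set_integral_mono[OF iA])
        show "set_integrable lebesgue A (\<lambda>z. 2 powr q * ((cmod (deriv \<phi> z) * cmod (G1 (\<phi> z))) powr q
           + (cmod (deriv \<phi> z) * cmod (G2 (\<phi> z))) powr q))"
          by (intro set_integrable_mult_right set_integral_add(1) conjunct1[OF g1] conjunct1[OF g2])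
      qed (rule pw[OF norm_ge_zero])
      also have "\<dots> = 2 powr q * (?I1 + ?I2)"
        by (simp only: set_integral_mult_right set_integral_add(2)[OF conjunct1[OF g1] conjunct1[OF g2]])
      also have "\<dots> \<le> 2 powr q * (K powr q * J powr (q / p) + K powr q * J powr (q / p))"
        by (intro mult_left_mono add_mono I1 I2) auto
      also have "\<dots> = c * J powr (q / p)" by (simp add: c_def)
      finally show ?thesis by (simp add: J_def)
    qed
    have "(\<lambda>n. LINT w:B|lebesgue. N n w powr p) \<longlonglongrightarrow> (LINT w:B|lebesgue. \<bar>a w\<bar> powr p)"
      unfolding set_lebesgue_integral_def
    proof (rule integral_dominated_convergence[where w="\<lambda>w. indicator B w *\<^sub>R N 0 w powr p"])
      show "(\<lambda>w. indicator B w *\<^sub>R \<bar>a w\<bar> powr p) \<in> borel_measurable lebesgue"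
        using ia unfolding set_integrable_def by (rule borel_measurable_integrable)
      show "(\<lambda>w. indicator B w *\<^sub>R N n w powr p) \<in> borel_measurable lebesgue" for n
        using iN[of n] unfolding set_integrable_def by (rule borel_measurable_integrable)
      show "integrable lebesgue (\<lambda>w. indicator B w *\<^sub>R N 0 w powr p)"
        using iN[of 0] by (simp add: set_integrable_def)
      show "AE w in lebesgue. (\<lambda>n. indicator B w *\<^sub>R N n w powr p) \<longlonglongrightarrow> indicator B w *\<^sub>R \<bar>a w\<bar> powr p"
      proof (rule AE_I2)
        fix w
        have "(\<lambda>n. cmod (Ga w) / real (Suc n)) \<longlonglongrightarrow> 0"
          by real_asymp
        then have "(\<lambda>n. N n w) \<longlonglongrightarrow> sqrt ((a w)\<^sup>2 + 0\<^sup>2)"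
          unfolding N_def by (intro tendsto_intros)
        then have "(\<lambda>n. N n w powr p) \<longlonglongrightarrow> \<bar>a w\<bar> powr p"
          using pq by (intro tendsto_powr') (auto simp: Npos)
        then show "(\<lambda>n. indicator B w *\<^sub>R N n w powr p) \<longlonglongrightarrow> indicator B w *\<^sub>R \<bar>a w\<bar> powr p"
          by (intro tendsto_scaleR tendsto_const)
      qed
      show "AE w in lebesgue. norm (indicator B w *\<^sub>R N n w powr p) \<le> indicator B w *\<^sub>R N 0 w powr p" for n
      proof (rule AE_I2)
        fix w
        have "cmod (Ga w) / real (Suc n) \<le> cmod (Ga w) / real (Suc 0)"
          by (intro divide_left_mono) auto
        then have "N n w \<le> N 0 w" unfolding N_def by (intro real_sqrt_le_mono add_left_mono power_mono) auto
        then have "N n w powr p \<le> N 0 w powr p" using pq by (intro powr_mono2 Npos) auto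
        then show "norm (indicator B w *\<^sub>R N n w powr p) \<le> indicator B w *\<^sub>R N 0 w powr p"
          by (auto simp: indicator_def)
      qed
    qed
    then have "(\<lambda>n. c * (LINT w:B|lebesgue. N n w powr p) powr (q / p)) \<longlonglongrightarrow>
        c * (LINT w:B|lebesgue. \<bar>a w\<bar> powr p) powr (q / p)"
      using pq by (intro tendsto_mult tendsto_const tendsto_powr')
        (auto simp: set_lebesgue_integral_def intro!: Bochner_Integration.integral_nonneg)
    then have "I \<le> c * (LINT w:B|lebesgue. \<bar>a w\<bar> powr p) powr (q / p)"
      by (rule Lim_bounded2[rule_format]) (use step in auto)
    then show ?thesis using ia iA by (simp add: I_def)
  qed
  note bound = this
  show ?thesis
  proof (rule exI[of _ c], rule conjI)
    show "0 \<le> c" by (simp add: c_def)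
  qed (intro allI impI, elim conjE, rule bound, assumption+, drule bspec, assumption+)
qed

text \<open>The radial cutoffs are smooth because \<open>|w|\<^sup>2\<close> is a polynomial in the coordinates.\<close>

lemma disc_cutoff_Ck:
  "Ck_on (ball 0 1) k (\<lambda>w. flat 0 (real m * (r - (cmod w)\<^sup>2)))"
proof -
  have Re: "Ck_on (ball 0 1) k (\<lambda>z. Re (c * z))" for c k
    by (intro Ck_on_Re_holomorphic holomorphic_intros) auto
  have "Ck_on (ball 0 1) k (\<lambda>w::complex. (real m * r + (- real m) * (Re (1 * w) * Re (1 * w) + Re (- \<i> * w) * Re (- \<i> * w))))" for k
    by (intro Ck_on_add Ck_on_mult Ck_on_const Re open_ball)
  moreover have "(real m * r + (- real m) * (Re (1 * w) * Re (1 * w) + Re (- \<i> * w) * Re (- \<i> * w))) =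
      real m * (r - (cmod w)\<^sup>2)" for w
    unfolding cmod_power2 by (simp add: power2_eq_square algebra_simps)
  ultimately have "Ck_on (ball 0 1) k (\<lambda>w::complex. real m * (r - (cmod w)\<^sup>2))" for k by simp
  then show ?thesis by (intro Ck_on_flat open_ball)
qed

text \<open>With a holomorphic logarithm \<open>H\<close> of \<open>f\<close>, the function is the squared modulus of the holomorphic
  function \<open>exp (\<alpha> H / 2)\<close>.\<close>

lemma modulus_powr_Ck:
  assumes S: "open S" "contractible S" and f: "f holomorphic_on S" "\<And>z. z \<in> S \<Longrightarrow> f z \<noteq> 0"
  shows "Ck_on S k (\<lambda>z. cmod (f z) powr \<alpha>)"
proof -
  obtain H where H: "H holomorphic_on S" "\<And>z. z \<in> S \<Longrightarrow> f z = exp (H z)"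
    using contractible_imp_holomorphic_log[OF f(1) S(2) f(2)] by metis
  define E where "E z = exp (of_real (\<alpha> / 2) * H z)" for z
  have E: "E holomorphic_on S" unfolding E_def by (intro holomorphic_intros H)
  have "Ck_on S k (\<lambda>z. Re (E z) * Re (E z) + Re (- \<i> * E z) * Re (- \<i> * E z))"
    by (intro Ck_on_add Ck_on_mult Ck_on_Re_holomorphic S E holomorphic_intros)
  then show ?thesis
  proof (rule Ck_on_cong[OF S(1)])
    fix z assume z: "z \<in> S"
    have "Re (E z) * Re (E z) + Re (- \<i> * E z) * Re (- \<i> * E z) = (cmod (E z))\<^sup>2"
      unfolding cmod_power2 by (simp add: power2_eq_square)
    also have "\<dots> = exp (\<alpha> / 2 * Re (H z)) * exp (\<alpha> / 2 * Re (H z))"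
      by (simp add: E_def power2_eq_square)
    also have "\<dots> = exp (\<alpha> * Re (H z))" by (simp add: exp_add[symmetric])
    also have "\<dots> = cmod (f z) powr \<alpha>" using H(2)[OF z] by (simp add: powr_def)
    finally show "Re (E z) * Re (E z) + Re (- \<i> * E z) * Re (- \<i> * E z) = cmod (f z) powr \<alpha>" .
  qed
qed

text \<open>The amplitude \<open>|h'|\<^bsup>\<alpha>\<^esup>\<close> with \<open>\<alpha> = (2 - s) / p\<close> is the one for which both sides of the amplitude
  inequality become the same integral of \<open>|\<phi>'|\<^sup>s\<close>, up to the cutoff. The cutoff is needed to make that integral
  finite before the inequality \<open>X \<le> c X\<^bsup>q/p\<^esup>\<close> is solved for \<open>X\<close>.\<close>

lemma composition_operator_bounded_imp_integrable:
  assumes A: "open A" "\<phi> holomorphic_on A" and hom: "homeomorphism A (ball 0 1) \<phi> h"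
    and pq: "0 < q" "q < p" and s: "s * (p - q) = q * (p - 2)"
    and gen: "generates_bounded_composition_operator p q A (ball 0 1) \<phi>"
  shows "(\<integral>\<^sup>+z\<in>A. ennreal (cmod (deriv \<phi> z) powr s) \<partial>lebesgue) < \<infinity>"
proof -
  define D where "D = ball (0::complex) 1"
  note hom = hom[folded D_def] and gen = gen[folded D_def]
  note bi = biholomorphic_derivs[OF A hom]
  have im: "\<phi> ` A = D" using hom by (auto simp: homeomorphism_def)
  have Am: "A \<in> sets lebesgue" using A by auto
  obtain c where c: "0 \<le> c"
    and amp0: "\<forall>a C. Ck_on D (Suc 0) a \<and> compact C \<and> C \<subseteq> D \<and> (\<forall>w\<in>D - C. a w = 0) \<longrightarrow>
       set_integrable lebesgue A (\<lambda>z. (cmod (deriv \<phi> z) * \<bar>a (\<phi> z)\<bar>) powr q) \<and>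
       set_integrable lebesgue D (\<lambda>w. \<bar>a w\<bar> powr p) \<and>
       (LINT z:A|lebesgue. (cmod (deriv \<phi> z) * \<bar>a (\<phi> z)\<bar>) powr q)
         \<le> c * (LINT w:D|lebesgue. \<bar>a w\<bar> powr p) powr (q / p)"
    using composition_bound_amplitude[OF A hom pq gen] by (elim exE conjE)
  have amp: "set_integrable lebesgue A (\<lambda>z. (cmod (deriv \<phi> z) * \<bar>a (\<phi> z)\<bar>) powr q) \<and>
       set_integrable lebesgue D (\<lambda>w. \<bar>a w\<bar> powr p) \<and>
       (LINT z:A|lebesgue. (cmod (deriv \<phi> z) * \<bar>a (\<phi> z)\<bar>) powr q)
         \<le> c * (LINT w:D|lebesgue. \<bar>a w\<bar> powr p) powr (q / p)"
    if "Ck_on D (Suc 0) a" "compact C" "C \<subseteq> D" "\<And>w. w \<in> D - C \<Longrightarrow> a w = 0" for a C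
    by (rule amp0[rule_format]) (use that in blast)
  define \<alpha> where "\<alpha> = (2 - s) / p"
  have exq: "q * (1 - \<alpha>) = s"
  proof -
    have "q * (1 - \<alpha>) = q * (p - 2 + s) / p" using pq by (simp add: \<alpha>_def field_simps)
    also have "q * (p - 2 + s) = s * p" using s by (simp add: algebra_simps)
    finally show ?thesis using pq by simp
  qed
  \<comment> \<open>As \<open>r m\<close> tends to 1, \<open>m (r m - |w|\<^sup>2)\<close> tends to infinity for every \<open>w\<close> in the disc, while
      \<open>r m < 1\<close> keeps the support of the cutoff compact in the disc.\<close>
  define r where "r m = real m / (real m + 1)" for m
  have r: "0 \<le> r m" "r m < 1" for m by (auto simp: r_def)
  define cut where "cut m w = flat 0 (real m * (r m - (cmod w)\<^sup>2))" for m and w :: complex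
  have cut: "0 \<le> cut m w" "cut m w \<le> 1" for m w by (simp_all add: cut_def flat_bounds)
  define u where "u m z = indicator A z * (cmod (deriv \<phi> z) powr s * cut m (\<phi> z) powr q)" for m z
  define b where "b = c powr (1 / (1 - q / p))"
  have bound: "integrable lebesgue (u m) \<and> (LINT z|lebesgue. u m z) \<le> b" for m
  proof -
    define a where "a w = cut m w * cmod (deriv h w) powr \<alpha>" for w
    define C where "C = cball (0::complex) (sqrt (r m))"
    have "sqrt (r m) < 1" using r by (simp add: real_sqrt_lt_1_iff)
    then have C: "compact C" "C \<subseteq> D"
      using le_less_trans[of _ "sqrt (r m)" 1] by (auto simp: C_def D_def)
    have dh: "deriv h w \<noteq> 0" if "w \<in> D" for w using bi(4)[OF that] by auto
    have "Ck_on D k (\<lambda>w. cmod (deriv h w) powr \<alpha>)" for k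
      by (rule modulus_powr_Ck) (auto simp: D_def convex_imp_contractible dh[unfolded D_def] bi(2)[unfolded D_def] intro!: holomorphic_deriv)
    then have Ck: "Ck_on D (Suc 0) a"
      unfolding a_def[abs_def] cut_def[abs_def]
      by (intro Ck_on_mult) (auto simp: D_def disc_cutoff_Ck simp del: Ck_on.simps)
    have a0: "a w = 0" if "w \<in> D - C" for w
    proof -
      have "sqrt (r m) < cmod w" using that by (simp add: C_def)
      then have "(sqrt (r m))\<^sup>2 < (cmod w)\<^sup>2" using r(1) by (intro power_strict_mono) auto
      then have "r m - (cmod w)\<^sup>2 < 0" using r(1) by simp
      then have "\<not> 0 < real m * (r m - (cmod w)\<^sup>2)" by (simp add: mult_le_0_iff not_less)
      then show ?thesis by (simp add: a_def cut_def flat_def)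
    qed
    have hd: "cmod (deriv h (\<phi> z)) = inverse (cmod (deriv \<phi> z))" "deriv \<phi> z \<noteq> 0" "\<phi> z \<in> D" if z: "z \<in> A" for z
    proof -
      show D: "\<phi> z \<in> D" using z im by blast
      have "h (\<phi> z) = z" using z hom by (simp add: homeomorphism_def)
      then have "cmod (deriv h (\<phi> z)) * cmod (deriv \<phi> z) = 1"
        using bi(4)[OF D] by (metis norm_mult norm_one)
      then show "cmod (deriv h (\<phi> z)) = inverse (cmod (deriv \<phi> z))" "deriv \<phi> z \<noteq> 0"
        using inverse_unique[of "cmod (deriv \<phi> z)" "cmod (deriv h (\<phi> z))"] by (auto simp: mult.commute)
    qed
    have absa: "\<bar>a (\<phi> z)\<bar> = cut m (\<phi> z) * cmod (deriv \<phi> z) powr (- \<alpha>)" if z: "z \<in> A" for z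
    proof -
      have "cmod (deriv h (\<phi> z)) powr \<alpha> = cmod (deriv \<phi> z) powr (- \<alpha>)"
        by (simp only: hd(1)[OF z] inverse_powr powr_minus)
      then show ?thesis using cut(1)[of m "\<phi> z"] by (simp add: a_def abs_mult)
    qed
    have lhs: "(cmod (deriv \<phi> z) * \<bar>a (\<phi> z)\<bar>) powr q = cmod (deriv \<phi> z) powr s * cut m (\<phi> z) powr q" if z: "z \<in> A" for z
    proof -
      let ?d = "cmod (deriv \<phi> z)"
      have d: "?d > 0" using hd(2)[OF z] by simp
      have "?d * \<bar>a (\<phi> z)\<bar> = (?d powr 1 * ?d powr (- \<alpha>)) * cut m (\<phi> z)"
        unfolding absa[OF z] using d by simp
      also have "\<dots> = ?d powr (1 - \<alpha>) * cut m (\<phi> z)"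
        unfolding powr_add[symmetric] by simp
      finally have "(?d * \<bar>a (\<phi> z)\<bar>) powr q = ?d powr ((1 - \<alpha>) * q) * cut m (\<phi> z) powr q"
        by (simp only: powr_mult powr_powr)
      then show ?thesis using exq by (simp only: mult.commute[of "1 - \<alpha>" q])
    qed
    have iu: "integrable lebesgue (u m)" and Iu: "(LINT z|lebesgue. u m z) = (LINT z:A|lebesgue. (cmod (deriv \<phi> z) * \<bar>a (\<phi> z)\<bar>) powr q)"
    proof -
      have eq: "(\<lambda>z. indicator A z *\<^sub>R (cmod (deriv \<phi> z) * \<bar>a (\<phi> z)\<bar>) powr q) = u m"
        by (rule ext) (auto simp: u_def indicator_def lhs)
      show "integrable lebesgue (u m)"
        using amp[OF Ck C a0] unfolding set_integrable_def eq by blast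
      show "(LINT z|lebesgue. u m z) = (LINT z:A|lebesgue. (cmod (deriv \<phi> z) * \<bar>a (\<phi> z)\<bar>) powr q)"
        unfolding set_lebesgue_integral_def eq ..
    qed
    define X where "X = (LINT z|lebesgue. u m z)"
    have X0: "0 \<le> X" unfolding X_def by (rule Bochner_Integration.integral_nonneg) (simp add: u_def)
    have rhs: "(LINT w:D|lebesgue. \<bar>a w\<bar> powr p) \<le> X"
    proof -
      have iD: "set_integrable lebesgue D (\<lambda>w. \<bar>a w\<bar> powr p)" using amp[OF Ck C a0] by blast
      note cov = holomorphic_change_of_variables[OF Am order_refl A bi(5), unfolded im, of "\<lambda>w. \<bar>a w\<bar> powr p"]
      have "(LINT w:D|lebesgue. \<bar>a w\<bar> powr p) = (LINT z:A|lebesgue. (cmod (deriv \<phi> z))\<^sup>2 * \<bar>a (\<phi> z)\<bar> powr p)"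
        using cov(2)[OF iD] by simp
      also have "\<dots> \<le> X" unfolding X_def set_lebesgue_integral_def
      proof (rule integral_mono[OF _ iu])
        show "integrable lebesgue (\<lambda>z. indicator A z *\<^sub>R ((cmod (deriv \<phi> z))\<^sup>2 * \<bar>a (\<phi> z)\<bar> powr p))"
          using cov(1) iD by (simp add: set_integrable_def)
        fix z
        show "indicator A z *\<^sub>R ((cmod (deriv \<phi> z))\<^sup>2 * \<bar>a (\<phi> z)\<bar> powr p) \<le> u m z"
        proof (cases "z \<in> A")
          case True
          let ?d = "cmod (deriv \<phi> z)" and ?x = "cut m (\<phi> z)"
          have d: "?d > 0" using hd(2)[OF True] by simp
          have "?d\<^sup>2 * \<bar>a (\<phi> z)\<bar> powr p = ?d powr 2 * (?x * ?d powr (- \<alpha>)) powr p"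
            unfolding absa[OF True] using d by simp
          also have "\<dots> = ?d powr 2 * (?x powr p * ?d powr (- \<alpha> * p))"
            by (simp only: powr_mult powr_powr)
          also have "\<dots> = ?d powr (2 + (- \<alpha> * p)) * ?x powr p"
            unfolding powr_add by (simp only: mult_ac)
          also have "2 + (- \<alpha> * p) = s" using pq by (simp add: \<alpha>_def)
          also have "?d powr s * ?x powr p \<le> ?d powr s * ?x powr q"
            using cut[of m "\<phi> z"] pq by (intro mult_left_mono powr_mono') auto
          finally show ?thesis using True by (simp add: u_def)
        qed (simp add: u_def)
      qed
      finally show ?thesis .
    qed
    \<comment> \<open>The cutoff enters with exponent \<open>q\<close> on the left and \<open>p > q\<close> on the right; being at most 1, it is
      smaller on the right.\<close>
    have "X \<le> c * X powr (q / p)"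
    proof -
      have "X \<le> c * (LINT w:D|lebesgue. \<bar>a w\<bar> powr p) powr (q / p)"
        using amp[OF Ck C a0] Iu by (simp add: X_def)
      also have "\<dots> \<le> c * X powr (q / p)"
      proof (intro mult_left_mono powr_mono2 rhs c)
        show "0 \<le> (LINT w:D|lebesgue. \<bar>a w\<bar> powr p)"
          unfolding set_lebesgue_integral_def by (rule Bochner_Integration.integral_nonneg) simp
      qed (use pq in auto)
      finally show ?thesis .
    qed
    have "X \<le> b"
    proof (cases "X = 0")
      case False
      then have X: "X > 0" using X0 by simp
      have th: "0 < 1 - q / p" using pq by simp
      have "X powr (1 - q / p) = X / X powr (q / p)" using X by (simp add: powr_diff)
      also have "\<dots> \<le> c" using \<open>X \<le> c * X powr (q / p)\<close> X by (simp add: divide_le_eq)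
      finally have "(X powr (1 - q / p)) powr (1 / (1 - q / p)) \<le> b"
        unfolding b_def using th by (intro powr_mono2) auto
      then show ?thesis using X pq by (simp add: powr_powr split: if_splits)
    qed (simp add: b_def)
    then show ?thesis using iu by (simp add: X_def)
  qed
  have lim: "(\<lambda>m. u m z) \<longlonglongrightarrow> indicator A z * cmod (deriv \<phi> z) powr s" for z
  proof (cases "z \<in> A")
    case True
    define t where "t = (cmod (\<phi> z))\<^sup>2"
    have "\<phi> z \<in> D" using True im by blast
    then have "cmod (\<phi> z) < 1" by (simp add: D_def)
    then have t: "t < 1" unfolding t_def by (simp add: power_less_one_iff abs_square_less_1)
    have lim0: "filterlim (\<lambda>m. real m * (real m / (real m + 1) - t)) at_top sequentially"
      using t by real_asymp
    have "(\<lambda>m. cut m (\<phi> z)) \<longlonglongrightarrow> 1"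
    proof (rule Lim_transform_eventually)
      show "(\<lambda>m. exp (- (1 / (real m * (r m - t))))) \<longlonglongrightarrow> 1"
        unfolding r_def using t by real_asymp
      show "\<forall>\<^sub>F m in sequentially. exp (- (1 / (real m * (r m - t)))) = cut m (\<phi> z)"
        using filterlim_at_top_dense[THEN iffD1, OF lim0, rule_format, of 0]
        by eventually_elim (simp add: cut_def flat_def r_def t_def)
    qed
    then have "(\<lambda>m. cut m (\<phi> z) powr q) \<longlonglongrightarrow> 1 powr q" by (intro tendsto_powr tendsto_const) auto
    then have "(\<lambda>m. u m z) \<longlonglongrightarrow> indicator A z * (cmod (deriv \<phi> z) powr s * 1 powr q)"
      unfolding u_def by (intro tendsto_mult tendsto_const)
    then show ?thesis by simp
  qed (simp add: u_def)
  have "(\<integral>\<^sup>+z\<in>A. ennreal (cmod (deriv \<phi> z) powr s) \<partial>lebesgue) = (\<integral>\<^sup>+z. liminf (\<lambda>m. ennreal (u m z)) \<partial>lebesgue)"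
  proof (rule nn_integral_cong)
    fix z
    have "(\<lambda>m. ennreal (u m z)) \<longlonglongrightarrow> ennreal (indicator A z * cmod (deriv \<phi> z) powr s)"
      by (rule tendsto_ennrealI[OF lim])
    then have "liminf (\<lambda>m. ennreal (u m z)) = ennreal (indicator A z * cmod (deriv \<phi> z) powr s)"
      using lim_imp_Liminf sequentially_bot by blast
    then show "ennreal (cmod (deriv \<phi> z) powr s) * indicator A z = liminf (\<lambda>m. ennreal (u m z))"
      by (simp add: indicator_def)
  qed
  also have "\<dots> \<le> liminf (\<lambda>m. \<integral>\<^sup>+z. ennreal (u m z) \<partial>lebesgue)"
    by (intro nn_integral_liminf measurable_compose[OF borel_measurable_integrable measurable_ennreal])
      (use bound in blast)
  also have "\<dots> \<le> liminf (\<lambda>m. ennreal b)"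
  proof (intro Liminf_mono always_eventually allI)
    fix m
    have "(\<integral>\<^sup>+z. ennreal (u m z) \<partial>lebesgue) = ennreal (LINT z|lebesgue. u m z)"
      by (rule nn_integral_eq_integral) (use bound[of m] in blast, simp add: u_def)
    also have "\<dots> \<le> ennreal b" using bound[of m] by (simp add: ennreal_leI)
    finally show "(\<integral>\<^sup>+z. ennreal (u m z) \<partial>lebesgue) \<le> ennreal b" .
  qed
  also have "\<dots> = ennreal b" by (simp add: Liminf_const)
  also have "\<dots> < \<infinity>" by simp
  finally show ?thesis .
qed

text \<open>Continuity of \<open>\<phi>'\<close>, which has no zeros, supplies the measurability that the nonnegative integral
  ignores.\<close>

lemma deriv_powr_integrable_iff:
  assumes A: "open A" "\<phi> holomorphic_on A" "inj_on \<phi> A"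
  shows "set_integrable lebesgue A (\<lambda>z. cmod (deriv \<phi> z) powr s) \<longleftrightarrow>
    (\<integral>\<^sup>+z\<in>A. ennreal (cmod (deriv \<phi> z) powr s) \<partial>lebesgue) < \<infinity>"
proof -
  have "continuous_on A (deriv \<phi>)"
    by (intro holomorphic_on_imp_continuous_on holomorphic_deriv A)
  then have "continuous_on A (\<lambda>z. cmod (deriv \<phi> z) powr s)"
    using holomorphic_injective_imp_regular[OF A(2,1,3)] by (intro continuous_on_powr continuous_intros) auto
  then have "(\<lambda>z. indicator A z * cmod (deriv \<phi> z) powr s) \<in> borel_measurable lebesgue"
    by (intro locally_summable_measurable[OF A(1)] locally_summable_continuous)
  moreover have "(\<integral>\<^sup>+z\<in>A. ennreal (cmod (deriv \<phi> z) powr s) \<partial>lebesgue) =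
     (\<integral>\<^sup>+z. ennreal (norm (indicator A z *\<^sub>R cmod (deriv \<phi> z) powr s)) \<partial>lebesgue)"
    by (rule nn_integral_cong) (simp add: indicator_def)
  ultimately show ?thesis
    unfolding set_integrable_def integrable_iff_bounded by simp
qed

lemma composition_exponent_relations:
  assumes "0 < s" "2 < p"
  shows "0 < composition_exponent p s" "composition_exponent p s < p"
    and "s * (p - composition_exponent p s) = composition_exponent p s * (p - 2)"
proof -
  have d: "0 < p + s - 2" using assms by simp
  show "0 < composition_exponent p s" using assms d by (simp add: composition_exponent_def)
  have "s < p + s - 2" using assms by simp
  then have "p * s < p * (p + s - 2)" using assms by (intro mult_strict_left_mono) auto
  then show "composition_exponent p s < p" using d by (simp add: composition_exponent_def divide_less_eq)
  show "s * (p - composition_exponent p s) = composition_exponent p s * (p - 2)"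
    using d by (simp add: composition_exponent_def field_simps)
qed

lemma conformal_composition_iff:
  assumes "open \<Omega>" and \<phi>: "conformal_homeomorphism \<Omega> (ball 0 1) \<phi>" and s: "0 < s" and p: "2 < p"
  shows "generates_bounded_composition_operator p (composition_exponent p s) \<Omega> (ball 0 1) \<phi> \<longleftrightarrow>
    (\<integral>\<^sup>+z\<in>\<Omega>. ennreal (cmod (deriv \<phi> z) powr s) \<partial>lebesgue) < \<infinity>"
proof -
  obtain h where h: "\<phi> holomorphic_on \<Omega>" "homeomorphism \<Omega> (ball 0 1) \<phi> h"
    using \<phi> by (auto simp: conformal_homeomorphism_def)
  note bi = biholomorphic_derivs[OF assms(1) h]
  note e = composition_exponent_relations[OF s p]
  show ?thesis
    using composition_operator_bounded[OF assms(1) h e]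
      composition_operator_bounded_imp_integrable[OF assms(1) h e]
      deriv_powr_integrable_iff[OF assms(1) h(1) bi(5), of s] by blast
qed

theorem mainTheorem1:
  fixes s :: real
  assumes "4 / 3 < s" and "s < 4"
  shows "brennan_conjecture_holds_for s \<longleftrightarrow>
    (\<forall>\<Omega> \<phi>. simply_connected_plane_domain \<Omega> \<and> frontier \<Omega> \<noteq> {} \<and>
           conformal_homeomorphism \<Omega> (ball 0 1) \<phi> \<longrightarrow>
       (\<forall>p>2. generates_bounded_composition_operator
                p (composition_exponent p s) \<Omega> (ball 0 1) \<phi>))"
proof -
  have "0 < s" using assms by simp
  have each: "(\<forall>p>2. generates_bounded_composition_operator
        p (composition_exponent p s) \<Omega> (ball 0 1) \<phi>) \<longleftrightarrow>
      (\<integral>\<^sup>+z\<in>\<Omega>. ennreal (cmod (deriv \<phi> z) powr s) \<partial>lebesgue) < \<infinity>"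
    if "simply_connected_plane_domain \<Omega>" "conformal_homeomorphism \<Omega> (ball 0 1) \<phi>" for \<Omega> \<phi>
  proof -
    have "open \<Omega>" using that(1) by (simp add: simply_connected_plane_domain_def)
    then show ?thesis
      using conformal_composition_iff[OF _ that(2) \<open>0 < s\<close>] gt_ex[of "2 :: real"] by blast
  qed
  show ?thesis unfolding brennan_conjecture_holds_for_def using each by blast
qed

end
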